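(* Let $P$ be a probability measure on $\mathbb S_{++}^d$, and define $$\|\lambda_{\min}\|_{1/2}=\Bigl(\int\sqrt{\lambda_{\min}(\Sigma)}\,dP(\Sigma)\Bigr)^2,\qquad\|\lambda_{\max}\|_1=\int\lambda_{\max}(\Sigma)\,dP(\Sigma),$$ with $\|\lambda_{\min}\|_{1/2}>0$ and $\|\lambda_{\max}\|_1<\infty$. Put $\bar\kappa=\|\lambda_{\max}\|_1/\|\lambda_{\min}\|_{1/2}$. Let $\Sigma^\star$ be the Bures--Wasserstein barycenter of $P$, let $\Sigma_0\in\operatorname{supp}P$, and let $\Sigma_T^{\rm GD}$ denote the $T$-th iterate of Riemannian gradient descent for the barycenter functional $F$ started at $\Sigma_0$ with step size $\eta=\frac{1}{2\bar\kappa}$. Then $$\frac{1}{2\sqrt{\bar\kappa}}\,W_2^2(\Sigma_T^{\rm GD},\Sigma^\star)\le F(\Sigma_T^{\rm GD})-F(\Sigma^\star)\le\exp\Bigl(-\frac{3T}{64\bar\kappa^{5/2}}\Bigr)\,\{F(\Sigma_0)-F(\Sigma^\star)\}.$$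
   Context: $\mathbb S_{++}^d$ is the set of real symmetric positive definite $d\times d$ matrices; $\lambda_{\min}(\Sigma),\lambda_{\max}(\Sigma)$ are the smallest and largest eigenvalues of $\Sigma$. For $\Sigma,\Sigma'\in\mathbb S_{++}^d$, $W_2(\Sigma,\Sigma')$ is the $2$-Wasserstein distance between $\mathcal N(0,\Sigma)$ and $\mathcal N(0,\Sigma')$: $W_2^2(\Sigma,\Sigma')=\operatorname{tr}[\Sigma+\Sigma'-2(\Sigma^{1/2}\Sigma'\Sigma^{1/2})^{1/2}]$. The matrix geometric mean is $\mathrm{GM}(A,B)=A^{1/2}(A^{-1/2}BA^{-1/2})^{1/2}A^{1/2}$. The barycenter functional is $F(\Sigma)=\frac12\int W_2^2(\Sigma,\Sigma')\,dP(\Sigma')$; the barycenter $\Sigma^\star$ is its minimizer over $\mathbb S_{++}^d$. Riemannian gradient descent with step size $\eta$: for $t\ge1$, $\Sigma_t=S_t\Sigma_{t-1}S_t$ with $S_t=(1-\eta)I_d+\eta\int\mathrm{GM}(\Sigma_{t-1}^{-1},\Sigma)\,dP(\Sigma)$. *)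

theory Defs
  imports "HOL-Probability.Probability"
begin

definition psd :: "(real^'n^'n) set" where
  "psd = {A. transpose A = A \<and> (\<forall>x. 0 \<le> x \<bullet> (A *v x))}"

definition spd :: "(real^'n^'n) set" where
  "spd = {A. transpose A = A \<and> (\<forall>x. x \<noteq> 0 \<longrightarrow> 0 < x \<bullet> (A *v x))}"

definition eigenvalues :: "real^'n^'n \<Rightarrow> real set" where
  "eigenvalues A = {l. \<exists>v. v \<noteq> 0 \<and> A *v v = l *\<^sub>R v}"

text \<open>Meaningful for symmetric matrices, whose set of real eigenvalues is finite and nonempty.\<close>

definition lambda_min :: "real^'n^'n \<Rightarrow> real" where
  "lambda_min A = Min (eigenvalues A)"

definition lambda_max :: "real^'n^'n \<Rightarrow> real" where
  "lambda_max A = Max (eigenvalues A)"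

text \<open>The positive semidefinite square root; meaningful for arguments in \<open>psd\<close>,
  where it exists and is unique.\<close>

definition mat_sqrt :: "real^'n^'n \<Rightarrow> real^'n^'n" where
  "mat_sqrt A = (THE R. R \<in> psd \<and> R ** R = A)"

definition GM :: "real^'n^'n \<Rightarrow> real^'n^'n \<Rightarrow> real^'n^'n" where
  "GM A B = mat_sqrt A **
     mat_sqrt (matrix_inv (mat_sqrt A) ** B ** matrix_inv (mat_sqrt A)) ** mat_sqrt A"

text \<open>The 2-Wasserstein distance between the centred Gaussians with covariances \<open>A\<close> and \<open>B\<close>.
  The radicand is nonnegative for \<open>A\<close>, \<open>B\<close> in \<open>spd\<close>.\<close>

definition W2 :: "real^'n^'n \<Rightarrow> real^'n^'n \<Rightarrow> real" where
  "W2 A B = sqrt (trace (A + B - 2 *\<^sub>R mat_sqrt (mat_sqrt A ** B ** mat_sqrt A)))"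

text \<open>Borel probability measures on the space \<open>spd\<close> itself, not on the ambient matrix space,
  so that measurability and integrals only involve values on \<open>spd\<close>.\<close>

definition spd_prob :: "(real^'n^'n) measure \<Rightarrow> bool" where
  "spd_prob P \<longleftrightarrow> prob_space P \<and> sets P = sets (restrict_space borel spd)"

definition supp :: "(real^'n^'n) measure \<Rightarrow> (real^'n^'n) set" where
  "supp P = {A \<in> space P. \<forall>U. open U \<and> A \<in> U \<longrightarrow> 0 < measure P (U \<inter> space P)}"

definition norm_lambda_min_half :: "(real^'n^'n) measure \<Rightarrow> real" where
  "norm_lambda_min_half P = (\<integral>A. sqrt (lambda_min A) \<partial>P)\<^sup>2"

definition norm_lambda_max_one :: "(real^'n^'n) measure \<Rightarrow> real" where
  "norm_lambda_max_one P = (\<integral>A. lambda_max A \<partial>P)"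

definition kappa_bar :: "(real^'n^'n) measure \<Rightarrow> real" where
  "kappa_bar P = norm_lambda_max_one P / norm_lambda_min_half P"

definition bary_F :: "(real^'n^'n) measure \<Rightarrow> real^'n^'n \<Rightarrow> real" where
  "bary_F P A = 1/2 * (\<integral>B. (W2 A B)\<^sup>2 \<partial>P)"

definition is_barycenter :: "(real^'n^'n) measure \<Rightarrow> real^'n^'n \<Rightarrow> bool" where
  "is_barycenter P A \<longleftrightarrow> is_arg_min (bary_F P) (\<lambda>B. B \<in> spd) A"

primrec gd :: "(real^'n^'n) measure \<Rightarrow> real \<Rightarrow> real^'n^'n \<Rightarrow> nat \<Rightarrow> real^'n^'n" where
  "gd P \<eta> A0 0 = A0"
| "gd P \<eta> A0 (Suc t) =
     (let S = (1 - \<eta>) *\<^sub>R mat 1 + \<eta> *\<^sub>R (\<integral>B. GM (matrix_inv (gd P \<eta> A0 t)) B \<partial>P)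
      in S ** gd P \<eta> A0 t ** S)"

end

theory Submission
  imports Defs
begin

text \<open>
  Write \<open>F\<close> for the barycenter functional, \<open>C\<close> for the barycenter and \<open>\<kappa>\<close> for the averaged condition number. At
  a positive definite \<open>A\<close>, let \<open>T\<^sub>B\<close> be the optimal transport map from \<open>A\<close> to \<open>B\<close>, let \<open>M\<close> be the average of
  \<open>T\<^sub>B\<close> over \<open>B\<close>, and let \<open>G = I - M\<close>, the Riemannian gradient of \<open>F\<close>, with squared norm
  \<open>N = trace (G A G)\<close>. Three inequalities carry the proof.

  Descent (\<open>gradient_step_decrease\<close>): a step of size \<open>\<eta> < 1\<close> lowers \<open>F\<close> by at least \<open>(\<eta> - \<eta>\<^sup>2/2) N\<close>,
  because the optimal couplings of the old point induce couplings of the new one. In particular the gradient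
  vanishes at \<open>C\<close>, and this fixed-point equation bounds the spectrum of \<open>C\<close> by the mean \<open>L\<close> of the largest
  eigenvalue.

  Variance inequality (\<open>variance_inequality\<close>): the gap \<open>F A - F C\<close> is at least \<open>W2\<^sup>2 / (2 sqrt \<kappa>)\<close>. The
  transport maps from \<open>C\<close> average to the identity, so their potentials are dual certificates for \<open>F C\<close>, and
  these potentials are strongly convex with mean modulus at least \<open>1 / sqrt \<kappa>\<close>. This is the left half of the
  theorem.

  Gradient domination (\<open>PL_inequality\<close>): the gap is at most \<open>5 \<kappa>\<^bsup>3/2\<^esup> N\<close> for every positive definite \<open>A\<close>. The
  functional is convex in \<open>A\<close> for the linear structure of matrices, but the tangent inequality degenerates
  where \<open>A\<close> is nearly singular, as the initial point may well be. What saves the estimate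
  is that \<open>M \<ge> a A\<^bsup>-1/2\<^esup>\<close>, where \<open>a\<close> is the mean of \<open>sqrt lambda_min\<close>: each eigendirection of \<open>A\<close> with eigenvalue below \<open>a\<^sup>2/4\<close> already forces \<open>N\<close> to be large. Such directions are removed from the
  tangent inequality at a cost of at most \<open>L = \<kappa> a\<^sup>2\<close> each (\<open>duality_bound\<close>), which \<open>N\<close> pays for; on the
  remaining directions \<open>C\<close> is dominated by \<open>4 \<kappa> A\<close>, and the variance inequality closes the estimate.

  Descent and gradient domination together contract the gap by a fixed factor in each step. Since they
  hold at every positive definite matrix, the iterates need not be tracked beyond their positive
  definiteness.
\<close>

section \<open>Matrices with the Frobenius inner product\<close>

lemma symmetric_inner_commute:
  fixes A :: "real^'n^'n"
  assumes "transpose A = A"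
  shows "x \<bullet> (A *v y) = (A *v x) \<bullet> y"
  by (metis assms dot_lmul_matrix transpose_matrix_vector)

lemma bounded_bilinear_matrix_mult:
  "bounded_bilinear ((**) :: real^'n^'n \<Rightarrow> real^'n^'n \<Rightarrow> real^'n^'n)"
proof -
  have "bilinear ((**) :: real^'n^'n \<Rightarrow> real^'n^'n \<Rightarrow> real^'n^'n)"
    unfolding bilinear_def
    by (auto intro!: linearI simp: matrix_add_ldistrib matrix_scalar_ac scalar_matrix_assoc
        matrix_matrix_mult_def vec_eq_iff sum.distrib sum_distrib_left algebra_simps)
  then show ?thesis
    by (simp add: bilinear_conv_bounded_bilinear)
qed

lemmas matrix_mult_distribs =
  bounded_bilinear.add_left[OF bounded_bilinear_matrix_mult]
  bounded_bilinear.add_right[OF bounded_bilinear_matrix_mult]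
  bounded_bilinear.diff_left[OF bounded_bilinear_matrix_mult]
  bounded_bilinear.diff_right[OF bounded_bilinear_matrix_mult]
  bounded_bilinear.scaleR_left[OF bounded_bilinear_matrix_mult]
  bounded_bilinear.scaleR_right[OF bounded_bilinear_matrix_mult]

lemma bounded_linear_transpose: "bounded_linear (transpose :: real^'n^'n \<Rightarrow> real^'n^'n)"
  by (simp add: linear_conv_bounded_linear[symmetric] linear_iff transpose_def vec_eq_iff)

lemmas transpose_distribs =
  linear_add[OF bounded_linear.linear[OF bounded_linear_transpose]]
  linear_diff[OF bounded_linear.linear[OF bounded_linear_transpose]]
  linear_cmul[OF bounded_linear.linear[OF bounded_linear_transpose]]

text \<open>The inner product that the vector type puts on matrices is the Frobenius inner product, so norms and
  inner products of matrices can stand for second moments: if \<open>X X\<^sup>T = A\<close> and \<open>Y Y\<^sup>T = B\<close>, then \<open>X\<close> and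
  \<open>Y\<close> encode a coupling of the centred Gaussians with covariances \<open>A\<close> and \<open>B\<close>, and \<open>(norm (X - Y))\<^sup>2\<close>
  is its transport cost.\<close>

lemma inner_matrix_trace:
  fixes A B :: "real^'n^'n"
  shows "A \<bullet> B = trace (transpose A ** B)"
  unfolding inner_vec_def trace_def transpose_def matrix_matrix_mult_def
  by (simp, rule sum.swap)

lemma inner_matrix_mult_left:
  fixes A B C :: "real^'n^'n"
  shows "(A ** B) \<bullet> C = B \<bullet> (transpose A ** C)"
  by (simp add: inner_matrix_trace matrix_transpose_mul matrix_mul_assoc)

lemma inner_matrix_mult_right:
  fixes A B C :: "real^'n^'n"
  shows "(A ** B) \<bullet> C = A \<bullet> (C ** transpose B)"
  by (simp add: inner_matrix_trace matrix_transpose_mul)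
     (metis matrix_mul_assoc trace_mul_sym)

lemma inner_transpose:
  fixes K L :: "real^'n^'n"
  shows "transpose K \<bullet> transpose L = K \<bullet> L"
  by (simp add: inner_vec_def transpose_def) (rule sum.swap)

section \<open>Diagonalization of symmetric matrices\<close>

definition orthonormal :: "('n \<Rightarrow> real^'n) \<Rightarrow> bool" where
  "orthonormal u \<longleftrightarrow> (\<forall>i j. u i \<bullet> u j = (if i = j then 1 else 0))"

text \<open>An orthonormal family indexed by the coordinates is the set of columns of an orthogonal matrix, which
  reduces the expansion to the equality of left and right inverses.\<close>

lemma orthonormal_expansion:
  fixes u :: "'n::finite \<Rightarrow> real^'n"
  assumes "orthonormal u"
  shows "x = (\<Sum>i\<in>UNIV. (u i \<bullet> x) *\<^sub>R u i)"
    and "x \<bullet> y = (\<Sum>i\<in>UNIV. (u i \<bullet> x) * (u i \<bullet> y))"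
proof -
  let ?U = "(\<chi> i j. u j $ i) :: real^'n^'n"
  have "transpose ?U ** ?U = mat 1"
    using assms
    by (simp add: orthonormal_def matrix_matrix_mult_def transpose_def mat_def vec_eq_iff inner_vec_def)
  then have "?U ** transpose ?U = mat 1"
    using matrix_left_right_inverse by blast
  then have eq: "x = ?U *v (transpose ?U *v x)" for x
    by (simp only: matrix_vector_mul_assoc matrix_vector_mul_lid)
  have t: "(transpose ?U *v x) $ i = u i \<bullet> x" for x i
    by (simp add: matrix_vector_mult_def transpose_def inner_vec_def del: transpose_matrix_vector)
  have "?U *v y = (\<Sum>i\<in>UNIV. (y $ i) *\<^sub>R u i)" for y
    by (simp add: matrix_vector_mult_def vec_eq_iff mult.commute)
  from eq[of x] this[of "transpose ?U *v x"]
  show x: "x = (\<Sum>i\<in>UNIV. (u i \<bullet> x) *\<^sub>R u i)"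
    by (simp only: t)
  have "x \<bullet> y = (\<Sum>i\<in>UNIV. (u i \<bullet> x) *\<^sub>R u i) \<bullet> y"
    by (rule arg_cong[of _ _ "\<lambda>z. z \<bullet> y", OF x])
  then show "x \<bullet> y = (\<Sum>i\<in>UNIV. (u i \<bullet> x) * (u i \<bullet> y))"
    by (simp add: inner_sum_left)
qed

lemma inner_matrix_orthonormal:
  fixes u :: "'n::finite \<Rightarrow> real^'n" and K L :: "real^'n^'n"
  assumes "orthonormal u"
  shows "K \<bullet> L = (\<Sum>i\<in>UNIV. (K *v u i) \<bullet> (L *v u i))"
proof -
  have "K \<bullet> L = (\<Sum>k\<in>UNIV. K $ k \<bullet> L $ k)"
    by (simp add: inner_vec_def)
  also have "\<dots> = (\<Sum>k\<in>UNIV. \<Sum>i\<in>UNIV. (u i \<bullet> K $ k) * (u i \<bullet> L $ k))"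
    using orthonormal_expansion(2)[OF assms] by (intro sum.cong refl)
  also have "\<dots> = (\<Sum>i\<in>UNIV. \<Sum>k\<in>UNIV. (u i \<bullet> K $ k) * (u i \<bullet> L $ k))"
    by (rule sum.swap)
  also have "\<dots> = (\<Sum>i\<in>UNIV. (K *v u i) \<bullet> (L *v u i))"
    by (simp add: inner_vec_def[of "_ *v _"] matrix_vector_mul_component inner_commute)
  finally show ?thesis .
qed

text \<open>A minimizer of the Rayleigh quotient on the compact unit sphere of \<open>S\<close> is an eigenvector.\<close>

lemma ex_min_eigenvector:
  fixes A :: "real^'n^'n"
  assumes sym: "transpose A = A" and S: "subspace S" and ne: "S \<noteq> {0}"
    and inv: "\<And>x. x \<in> S \<Longrightarrow> A *v x \<in> S"
  obtains v l where "v \<in> S" "norm v = 1" "A *v v = l *\<^sub>R v"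
    "\<And>x. x \<in> S \<Longrightarrow> l * (x \<bullet> x) \<le> x \<bullet> (A *v x)"
proof -
  let ?K = "S \<inter> sphere 0 1"
  have "compact ?K"
    using closed_subspace[OF S] by (simp add: closed_Int_compact)
  moreover obtain y where y: "y \<in> S" "y \<noteq> 0"
    using ne subspace_0[OF S] by auto
  then have "(1 / norm y) *\<^sub>R y \<in> ?K"
    using subspace_scale[OF S] by simp
  then have "?K \<noteq> {}" by blast
  moreover have "continuous_on ?K (\<lambda>x. x \<bullet> (A *v x))"
    by (intro continuous_intros linear_continuous_on linear_conv_bounded_linear[THEN iffD1]) simp
  ultimately obtain v where v: "v \<in> ?K" and min: "\<And>x. x \<in> ?K \<Longrightarrow> v \<bullet> (A *v v) \<le> x \<bullet> (A *v x)"
    using continuous_attains_inf[of ?K "\<lambda>x. x \<bullet> (A *v x)"] by blast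
  define l where "l = v \<bullet> (A *v v)"
  have vS: "v \<in> S" and nv: "norm v = 1" using v by auto
  have vv: "v \<bullet> v = 1" using nv by (simp add: norm_eq_1)
  have ge: "l * (x \<bullet> x) \<le> x \<bullet> (A *v x)" if "x \<in> S" for x
  proof (cases "x = 0")
    case False
    then have "(1 / norm x) *\<^sub>R x \<in> ?K"
      using that subspace_scale[OF S] by simp
    from min[OF this] have "l \<le> (x \<bullet> (A *v x)) / (norm x)\<^sup>2"
      by (simp add: l_def matrix_vector_mult_scaleR power2_eq_square)
    then show ?thesis
      using False by (simp add: field_simps power2_norm_eq_inner)
  qed simp
  define w where "w = A *v v - l *\<^sub>R v"
  have wS: "w \<in> S"
    unfolding w_def using inv vS S by (simp add: subspace_diff subspace_scale)
  \<comment> \<open>the form \<open>q x = x \<bullet> A x - l (x \<bullet> x)\<close> is nonnegative on \<open>S\<close> and vanishes at \<open>v\<close>, so its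
      derivative there in the direction \<open>w\<close> vanishes; that derivative is \<open>2 (w \<bullet> w)\<close>\<close>
  define c where "c = w \<bullet> (A *v w) - l * (w \<bullet> w)"
  have q: "0 \<le> 2 * t * (w \<bullet> w) + t\<^sup>2 * c" for t
  proof -
    have "v + t *\<^sub>R w \<in> S" using vS wS S by (simp add: subspace_add subspace_scale)
    from ge[OF this] have "l * ((v + t *\<^sub>R w) \<bullet> (v + t *\<^sub>R w))
        \<le> (v + t *\<^sub>R w) \<bullet> (A *v (v + t *\<^sub>R w))" .
    moreover have "v \<bullet> (A *v w) = w \<bullet> (A *v v)"
      using symmetric_inner_commute[OF sym, of v w] by (simp add: inner_commute)
    moreover have "w \<bullet> (A *v v) = w \<bullet> w + l * (w \<bullet> v)"
      by (simp add: w_def algebra_simps)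
    ultimately show ?thesis
      using vv
      by (simp add: l_def[symmetric] c_def algebra_simps power2_eq_square inner_commute[of v w])
  qed
  have "w \<bullet> w = 0"
  proof (rule ccontr)
    assume "w \<bullet> w \<noteq> 0"
    then have pos: "w \<bullet> w > 0" by simp
    define t where "t = - (w \<bullet> w) / (\<bar>c\<bar> + 1)"
    have t: "t < 0" using pos by (simp add: t_def divide_neg_pos)
    have "\<bar>t\<bar> * \<bar>c\<bar> \<le> w \<bullet> w"
      using pos by (simp add: t_def abs_mult field_simps)
    then have "t * c \<ge> - (w \<bullet> w)"
      by (metis abs_le_iff abs_mult minus_le_iff)
    then have "t * (2 * (w \<bullet> w) + t * c) < 0"
      using t pos by (intro mult_neg_pos) linarith+
    moreover have "t * (2 * (w \<bullet> w) + t * c) = 2 * t * (w \<bullet> w) + t\<^sup>2 * c"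
      by (simp add: algebra_simps power2_eq_square)
    ultimately show False using q[of t] by linarith
  qed
  then have "A *v v = l *\<^sub>R v" by (simp add: w_def)
  from vS nv this ge show thesis by (rule that)
qed

text \<open>Split off a minimal eigenvector and continue on its orthogonal complement, which symmetry keeps
  invariant.\<close>

lemma spectral_invariant_subspace:
  fixes A :: "real^'n^'n"
  assumes sym: "transpose A = A" and "subspace S" and "\<And>x. x \<in> S \<Longrightarrow> A *v x \<in> S"
  shows "\<exists>B. B \<subseteq> S \<and> pairwise orthogonal B \<and> span B = S \<and>
    (\<forall>v\<in>B. norm v = 1 \<and> (\<exists>l. A *v v = l *\<^sub>R v))"
  using assms(2,3)
proof (induction "dim S" arbitrary: S rule: less_induct)
  case less
  show ?case
  proof (cases "S = {0}")
    case True
    then show ?thesis by (intro exI[of _ "{}"]) (auto simp: pairwise_def)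
  next
    case False
    obtain v l where v: "v \<in> S" "norm v = 1" "A *v v = l *\<^sub>R v"
      using ex_min_eigenvector[OF sym less.prems(1) False less.prems(2)] by metis
    define S' where "S' = S \<inter> {x. v \<bullet> x = 0}"
    have sub: "subspace S'"
      unfolding S'_def using less.prems(1) by (intro subspace_inter subspace_hyperplane)
    have vv: "v \<bullet> v = 1" using v by (simp add: norm_eq_1)
    have "S' \<subseteq> S" "v \<notin> S'" using vv by (auto simp: S'_def)
    then have "dim S' < dim S"
      using v(1) dim_psubset[of S' S] sub less.prems(1) by (metis span_eq_iff psubsetI)
    moreover have "A *v x \<in> S'" if "x \<in> S'" for x
      using that less.prems(2) symmetric_inner_commute[OF sym, of v x] v(3)
      by (auto simp: S'_def)
    ultimately obtain B where B: "B \<subseteq> S'" "pairwise orthogonal B" "span B = S'"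
        "\<forall>v\<in>B. norm v = 1 \<and> (\<exists>l. A *v v = l *\<^sub>R v)"
      using less.hyps[OF _ sub] by blast
    have "pairwise orthogonal (insert v B)"
      using B(1,2) by (auto simp: pairwise_insert S'_def orthogonal_def inner_commute)
    moreover have "span (insert v B) = S"
    proof
      show "span (insert v B) \<subseteq> S"
        using B(1) v(1) \<open>S' \<subseteq> S\<close> less.prems(1) by (intro span_minimal) auto
      show "S \<subseteq> span (insert v B)"
      proof
        fix x assume x: "x \<in> S"
        have "x - (v \<bullet> x) *\<^sub>R v \<in> S'"
          using x v(1) vv less.prems(1)
          by (auto simp: S'_def inner_diff_right intro: subspace_diff subspace_scale)
        then have "x - (v \<bullet> x) *\<^sub>R v \<in> span B" using B(3) by simp
        then show "x \<in> span (insert v B)" by (auto simp: span_insert)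
      qed
    qed
    ultimately show ?thesis
      using B v \<open>S' \<subseteq> S\<close> by (intro exI[of _ "insert v B"]) auto
  qed
qed

theorem symmetric_diagonalizable:
  fixes A :: "real^'n^'n"
  assumes "transpose A = A"
  obtains u :: "'n \<Rightarrow> real^'n" and l where "orthonormal u" "\<And>i. A *v u i = l i *\<^sub>R u i"
proof -
  obtain B where B: "pairwise orthogonal B" "span B = (UNIV :: (real^'n) set)"
      "\<forall>v\<in>B. norm v = 1 \<and> (\<exists>l. A *v v = l *\<^sub>R v)"
    using spectral_invariant_subspace[OF assms, of UNIV] by auto
  have "0 \<notin> B" using B(3) by force
  then have ind: "independent B" using B(1) pairwise_orthogonal_independent by blast
  have "card B = CARD('n)"
    using basis_card_eq_dim[of B UNIV] ind B(2) by simp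
  moreover have "finite B" using ind by (rule independent_imp_finite)
  ultimately obtain u where u: "bij_betw u (UNIV :: 'n set) B"
    by (metis finite_same_card_bij finite)
  have "orthonormal u"
    using u B(1,3) unfolding orthonormal_def bij_betw_def pairwise_def orthogonal_def
    by (metis (no_types, lifting) UNIV_I image_eqI inj_eq norm_eq_1)
  moreover have "\<forall>i. \<exists>l. A *v u i = l *\<^sub>R u i"
    using u B(3) by (auto simp: bij_betw_def)
  then obtain l where "\<And>i. A *v u i = l i *\<^sub>R u i" by metis
  ultimately show thesis by (rule that)
qed

section \<open>Positive definite matrices and their square roots\<close>

lemma psd_inner_matrix:
  fixes A K :: "real^'n^'n"
  assumes "A \<in> psd"
  shows "0 \<le> K \<bullet> (A ** K)"
proof -
  have on: "orthonormal (\<lambda>i. axis i 1 :: real^'n)"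
    by (simp add: orthonormal_def inner_axis_axis)
  show ?thesis
    using assms unfolding inner_matrix_orthonormal[OF on]
    by (simp add: psd_def sum_nonneg flip: matrix_vector_mul_assoc)
qed

lemma spd_imp_psd: "A \<in> spd \<Longrightarrow> A \<in> psd"
  unfolding spd_def psd_def by (auto simp: less_imp_le) (metis inner_zero_left less_imp_le order_refl)

lemma psd_symmetric: "A \<in> psd \<Longrightarrow> transpose A = A"
  and spd_symmetric: "A \<in> spd \<Longrightarrow> transpose A = A"
  and psd_nonneg: "A \<in> psd \<Longrightarrow> 0 \<le> x \<bullet> (A *v x)"
  and spd_pos: "A \<in> spd \<Longrightarrow> x \<noteq> 0 \<Longrightarrow> 0 < x \<bullet> (A *v x)"
  by (auto simp: psd_def spd_def)

lemma spd_invertible: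
  assumes "A \<in> spd"
  shows "invertible A"
proof -
  have "x = 0" if "A *v x = 0" for x
    using spd_pos[OF assms, of x] that by auto
  then show ?thesis
    by (metis invertible_def matrix_left_invertible_ker matrix_left_right_inverse)
qed

lemma matrix_inv_mult:
  assumes "invertible (A :: real^'n^'n)"
  shows "A ** matrix_inv A = mat 1" and "matrix_inv A ** A = mat 1"
  using someI_ex[OF assms[unfolded invertible_def]] by (auto simp: matrix_inv_def)

lemma matrix_inv_unique:
  assumes "A ** B = mat 1"
  shows "matrix_inv A = (B :: real^'n^'n)"
proof -
  have "invertible A"
    using assms invertible_def matrix_left_right_inverse by blast
  then show ?thesis
    by (metis assms matrix_inv_mult(2) matrix_mul_assoc matrix_mul_lid matrix_mul_rid)
qed

lemma spd_congruence:
  assumes A: "A \<in> spd" and K: "invertible K"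
  shows "transpose K ** A ** K \<in> spd"
proof -
  have "x \<bullet> ((transpose K ** A ** K) *v x) = (K *v x) \<bullet> (A *v (K *v x))" for x
    by (simp add: dot_lmul_matrix flip: matrix_vector_mul_assoc)
       (metis dot_lmul_matrix inner_commute)
  moreover have "K *v x \<noteq> 0" if "x \<noteq> 0" for x
    using that inj_matrix_vector_mult[OF K] by (metis injD matrix_vector_mult_0_right)
  ultimately show ?thesis
    using A by (simp add: spd_def matrix_transpose_mul matrix_mul_assoc)
qed

lemma spd_congruence_spd:
  "A \<in> spd \<Longrightarrow> K \<in> spd \<Longrightarrow> K ** A ** K \<in> spd"
  using spd_congruence[of A K] by (simp add: spd_symmetric spd_invertible)

lemma spd_matrix_inv:
  assumes A: "A \<in> spd"
  shows "matrix_inv A \<in> spd"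
proof -
  let ?B = "matrix_inv A"
  note inv = matrix_inv_mult[OF spd_invertible[OF A]]
  have "transpose ?B ** A = mat 1"
    using inv(1) spd_symmetric[OF A] by (metis matrix_transpose_mul transpose_mat)
  then have "transpose ?B = ?B"
    by (metis inv(1) matrix_mul_assoc matrix_mul_lid matrix_mul_rid)
  moreover have "invertible ?B" using inv by (auto simp: invertible_def)
  ultimately have "?B ** A ** ?B \<in> spd"
    using spd_congruence[OF A, of ?B] by simp
  then show ?thesis by (simp add: inv)
qed

lemma spd_add_psd:
  "A \<in> spd \<Longrightarrow> B \<in> psd \<Longrightarrow> A + B \<in> spd"
  by (auto simp: spd_def psd_def transpose_distribs algebra_simps add_pos_nonneg)

lemma psd_scaleR: "A \<in> psd \<Longrightarrow> 0 \<le> c \<Longrightarrow> c *\<^sub>R A \<in> psd"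
  by (auto simp: psd_def transpose_distribs simp flip: scaleR_matrix_vector_assoc)

lemma psd_add: "A \<in> psd \<Longrightarrow> B \<in> psd \<Longrightarrow> A + B \<in> psd"
  by (auto simp: psd_def transpose_distribs algebra_simps)

lemma spd_mat: "0 < c \<Longrightarrow> c *\<^sub>R (mat 1 :: real^'n^'n) \<in> spd"
  by (auto simp: spd_def transpose_distribs simp flip: scaleR_matrix_vector_assoc)

lemma ex_min_eigenvector_matrix:
  fixes A :: "real^'n^'n"
  assumes "transpose A = A"
  obtains v l where "norm v = 1" "A *v v = l *\<^sub>R v" "\<And>x. l * (x \<bullet> x) \<le> x \<bullet> (A *v x)"
proof -
  have "(UNIV :: (real^'n) set) \<noteq> {0}"
    by (metis UNIV_I axis_eq_0_iff singletonD zero_neq_one)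
  then show thesis
    using ex_min_eigenvector[OF assms, of UNIV] that by auto
qed

text \<open>Operator monotonicity of the square root, in the form: squaring reflects the Loewner order. It yields
  uniqueness and continuity of the matrix square root as well as all lower bounds on transport maps.\<close>

lemma psd_sqrt_mono:
  fixes H K :: "real^'n^'n"
  assumes H: "H \<in> psd" and K: "K \<in> psd" and le: "\<And>x. x \<bullet> ((K ** K) *v x) \<le> x \<bullet> ((H ** H) *v x)"
  shows "x \<bullet> (K *v x) \<le> x \<bullet> (H *v x)"
proof -
  note symH = symmetric_inner_commute[OF psd_symmetric[OF H]]
    and symK = symmetric_inner_commute[OF psd_symmetric[OF K]]
  have "transpose (H - K) = H - K"
    using psd_symmetric[OF H] psd_symmetric[OF K] by (simp add: transpose_distribs)
  then obtain v l where v: "norm v = 1" "(H - K) *v v = l *\<^sub>R v"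
    and min: "\<And>x. l * (x \<bullet> x) \<le> x \<bullet> ((H - K) *v x)"
    by (rule ex_min_eigenvector_matrix) blast
  have vv: "v \<bullet> v = 1" using v(1) by (simp add: norm_eq_1)
  have Hv: "H *v v = K *v v + l *\<^sub>R v" using v(2) by (simp add: algebra_simps)
  have "(K *v v) \<bullet> (K *v v) \<le> (H *v v) \<bullet> (H *v v)"
    using le[of v] by (simp add: symH symK flip: matrix_vector_mul_assoc)
  \<comment> \<open>this difference of squares equals \<open>l (v \<bullet> H v + v \<bullet> K v)\<close>, so \<open>l < 0\<close> would force both
      quadratic forms, hence \<open>l\<close> itself, to vanish\<close>
  then have "0 \<le> l * (v \<bullet> (H *v v) + v \<bullet> (K *v v))"
    using vv by (simp add: Hv algebra_simps inner_commute)
  moreover have "0 \<le> v \<bullet> (H *v v)" "0 \<le> v \<bullet> (K *v v)"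
    using H K by (auto simp: psd_def)
  moreover have "v \<bullet> (H *v v) = v \<bullet> (K *v v) + l"
    using vv by (simp add: Hv algebra_simps)
  ultimately have "0 \<le> l"
    by (smt (verit) mult_neg_pos)
  then have "0 \<le> x \<bullet> ((H - K) *v x)"
    using min[of x] by (smt (verit) inner_ge_zero mult_nonneg_nonneg)
  then show ?thesis by (simp add: algebra_simps)
qed

lemma symmetric_matrix_eqI:
  fixes A B :: "real^'n^'n"
  assumes A: "transpose A = A" and B: "transpose B = B"
    and eq: "\<And>x. x \<bullet> (A *v x) = x \<bullet> (B *v x)"
  shows "A = B"
proof -
  have "transpose (A - B) = A - B" using A B by (simp add: transpose_distribs)
  then obtain u l where u: "orthonormal u" "\<And>i. (A - B) *v u i = l i *\<^sub>R u i"
    using symmetric_diagonalizable by blast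
  have "l i = 0" for i
  proof -
    have "u i \<bullet> ((A - B) *v u i) = 0" using eq[of "u i"] by (simp add: algebra_simps)
    moreover have "u i \<bullet> u i = 1" using u(1) by (simp add: orthonormal_def)
    ultimately show ?thesis by (simp add: u(2))
  qed
  then have "(A - B) \<bullet> (A - B) = 0"
    by (simp add: inner_matrix_orthonormal[OF u(1)] u(2))
  then show ?thesis by simp
qed

text \<open>Equal squares are comparable in both directions.\<close>

lemma psd_sqrt_unique:
  fixes H K :: "real^'n^'n"
  assumes "H \<in> psd" "K \<in> psd" "H ** H = K ** K"
  shows "H = K"
proof (rule symmetric_matrix_eqI)
  show "x \<bullet> (H *v x) = x \<bullet> (K *v x)" for x
    using psd_sqrt_mono[of H K x] psd_sqrt_mono[of K H x] assms by simp
qed (use assms psd_symmetric in auto)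

lemma orthonormal_matrix_eqI:
  fixes A B :: "real^'n^'n"
  assumes "orthonormal u" "\<And>i. A *v u i = B *v u i"
  shows "A = B"
proof -
  have "(A - B) \<bullet> (A - B) = 0"
    using assms by (simp add: inner_matrix_orthonormal[OF assms(1)] algebra_simps)
  then show ?thesis by simp
qed

text \<open>Functional calculus for a symmetric matrix diagonalized by \<open>u\<close>; it provides both the square root and
  spectral projectors.\<close>

definition spectral_matrix :: "('n \<Rightarrow> real^'n) \<Rightarrow> ('n \<Rightarrow> real) \<Rightarrow> real^'n^'n" where
  "spectral_matrix u l = (\<Sum>i\<in>UNIV. l i *\<^sub>R (\<chi> a b. u i $ a * u i $ b))"

lemma spectral_matrix_apply:
  "spectral_matrix u l *v x = (\<Sum>i\<in>UNIV. (l i * (u i \<bullet> x)) *\<^sub>R u i)"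
proof -
  have "(\<Sum>i\<in>I. l i *\<^sub>R (\<chi> a b. u i $ a * u i $ b)) *v x = (\<Sum>i\<in>I. (l i * (u i \<bullet> x)) *\<^sub>R u i)"
    if "finite I" for I :: "'a set"
    using that
  proof (induction I)
    case (insert i I)
    have "(\<chi> a b. u i $ a * u i $ b) *v x = (u i \<bullet> x) *\<^sub>R u i"
      by (simp add: vec_eq_iff matrix_vector_mult_def inner_vec_def sum_distrib_left
          sum_distrib_right mult_ac)
    then show ?case
      using insert by (simp add: algebra_simps flip: scaleR_matrix_vector_assoc)
  qed simp
  then show ?thesis by (simp add: spectral_matrix_def)
qed

lemma spectral_matrix_basis:
  assumes "orthonormal u"
  shows "spectral_matrix u l *v u i = l i *\<^sub>R u i"
proof -
  have "(l j * (u j \<bullet> u i)) *\<^sub>R u j = (if j = i then l i *\<^sub>R u i else 0)" for j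
    using assms by (auto simp: orthonormal_def)
  then show ?thesis by (simp add: spectral_matrix_apply)
qed

lemma spectral_matrix_symmetric: "transpose (spectral_matrix u l) = spectral_matrix u l"
  by (simp add: spectral_matrix_def vec_eq_iff transpose_def sum_component mult_ac)

lemma spectral_matrix_quadratic_form:
  "x \<bullet> (spectral_matrix u l *v x) = (\<Sum>i\<in>UNIV. l i * (u i \<bullet> x)\<^sup>2)"
  by (simp add: spectral_matrix_apply inner_sum_right power2_eq_square inner_commute mult_ac)

lemma psd_sqrt_exists:
  fixes A :: "real^'n^'n"
  assumes A: "A \<in> psd"
  obtains R where "R \<in> psd" "R ** R = A"
proof -
  obtain u l where u: "orthonormal u" "\<And>i. A *v u i = l i *\<^sub>R u i"
    using symmetric_diagonalizable[OF psd_symmetric[OF A]] by blast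
  have l: "0 \<le> l i" for i
    using psd_nonneg[OF A, of "u i"] u by (simp add: orthonormal_def)
  let ?R = "spectral_matrix u (\<lambda>i. sqrt (l i))"
  have "?R \<in> psd"
    using l by (simp add: psd_def spectral_matrix_symmetric spectral_matrix_quadratic_form sum_nonneg)
  moreover have "?R ** ?R = A"
    using u l by (intro orthonormal_matrix_eqI[OF u(1)])
      (simp add: spectral_matrix_basis algebra_simps flip: matrix_vector_mul_assoc)
  ultimately show thesis by (rule that)
qed

lemma mat_sqrt:
  assumes "A \<in> psd"
  shows mat_sqrt_psd: "mat_sqrt A \<in> psd" and mat_sqrt_square: "mat_sqrt A ** mat_sqrt A = A"
proof -
  have "\<exists>!R. R \<in> psd \<and> R ** R = A"
    using psd_sqrt_exists[OF assms] psd_sqrt_unique by metis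
  from theI'[OF this] show "mat_sqrt A \<in> psd" "mat_sqrt A ** mat_sqrt A = A"
    by (simp_all add: mat_sqrt_def)
qed

lemma mat_sqrt_eqI:
  assumes "R \<in> psd" "R ** R = A"
  shows "mat_sqrt A = R"
  unfolding mat_sqrt_def using assms psd_sqrt_unique by (intro the_equality) auto

lemma mat_sqrt_spd:
  assumes A: "A \<in> spd"
  shows "mat_sqrt A \<in> spd"
proof -
  let ?R = "mat_sqrt A"
  note R = mat_sqrt[OF spd_imp_psd[OF A]]
  \<comment> \<open>an invertible positive semidefinite matrix \<open>R\<close> is the congruence transform \<open>S S\<close> of the identity by
      its own (invertible) root\<close>
  obtain S where S: "S \<in> psd" "S ** S = ?R" using psd_sqrt_exists[OF R(1)] .
  have "(S ** (S ** ?R)) ** matrix_inv A = mat 1"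
    using R(2) S(2) matrix_inv_mult(1)[OF spd_invertible[OF A]] by (simp add: matrix_mul_assoc)
  then have "S ** ((S ** ?R) ** matrix_inv A) = mat 1" by (simp add: matrix_mul_assoc)
  then have "invertible S" using invertible_right_inverse by blast
  from spd_congruence[OF _ this, of "mat 1"] spd_mat[of 1] S psd_symmetric[OF S(1)]
  show ?thesis by simp
qed

lemma mat_sqrt_matrix_inv:
  assumes A: "A \<in> spd"
  shows "mat_sqrt (matrix_inv A) = matrix_inv (mat_sqrt A)"
proof (rule mat_sqrt_eqI)
  let ?R = "mat_sqrt A"
  note R = mat_sqrt_square[OF spd_imp_psd[OF A]] mat_sqrt_spd[OF A]
  note inv = matrix_inv_mult[OF spd_invertible[OF R(2)]]
  show "matrix_inv ?R \<in> psd" by (intro spd_imp_psd spd_matrix_inv R)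
  have "A ** (matrix_inv ?R ** matrix_inv ?R) = (?R ** ?R) ** (matrix_inv ?R ** matrix_inv ?R)"
    by (simp only: R(1))
  also have "\<dots> = ?R ** (?R ** matrix_inv ?R) ** matrix_inv ?R"
    by (simp only: matrix_mul_assoc)
  also have "\<dots> = mat 1" by (simp add: inv)
  finally show "matrix_inv ?R ** matrix_inv ?R = matrix_inv A"
    by (rule matrix_inv_unique[symmetric])
qed

lemma matrix_inv_matrix_inv:
  assumes "invertible (A :: real^'n^'n)"
  shows "matrix_inv (matrix_inv A) = A"
  using matrix_inv_mult(2)[OF assms] by (rule matrix_inv_unique)

section \<open>Optimal transport between centred Gaussians\<close>

text \<open>The optimal transport map between the centred Gaussians with covariances \<open>A\<close> and \<open>B\<close> is linear, with
  this positive definite matrix. The geometric mean is kept because the gradient step is written with it.\<close>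

definition OT :: "real^'n^'n \<Rightarrow> real^'n^'n \<Rightarrow> real^'n^'n" where
  "OT A B = GM (matrix_inv A) B"

lemma OT_eq:
  assumes A: "A \<in> spd"
  shows "OT A B = matrix_inv (mat_sqrt A) ** mat_sqrt (mat_sqrt A ** B ** mat_sqrt A)
    ** matrix_inv (mat_sqrt A)"
  by (simp add: OT_def GM_def mat_sqrt_matrix_inv[OF A]
      matrix_inv_matrix_inv[OF spd_invertible[OF mat_sqrt_spd[OF A]]])

lemma OT_sandwich:
  assumes A: "A \<in> spd"
  shows "mat_sqrt A ** OT A B ** mat_sqrt A = mat_sqrt (mat_sqrt A ** B ** mat_sqrt A)"
proof -
  note inv = matrix_inv_mult[OF spd_invertible[OF mat_sqrt_spd[OF A]]]
  let ?R = "mat_sqrt A" and ?S = "mat_sqrt (mat_sqrt A ** B ** mat_sqrt A)"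
  have "?R ** OT A B ** ?R = (?R ** matrix_inv ?R) ** ?S ** (matrix_inv ?R ** ?R)"
    by (simp add: OT_eq[OF A] matrix_mul_assoc)
  then show ?thesis by (simp add: inv)
qed

lemma OT_spd:
  assumes A: "A \<in> spd" and B: "B \<in> spd"
  shows "OT A B \<in> spd"
  unfolding OT_eq[OF A]
  by (intro spd_congruence_spd mat_sqrt_spd spd_matrix_inv A B)

lemma OT_pushforward:
  assumes A: "A \<in> spd" and B: "B \<in> spd"
  shows "OT A B ** A ** OT A B = B"
proof -
  let ?R = "mat_sqrt A" and ?S = "mat_sqrt (mat_sqrt A ** B ** mat_sqrt A)"
  let ?I = "matrix_inv ?R"
  note inv = matrix_inv_mult[OF spd_invertible[OF mat_sqrt_spd[OF A]]]
  have R: "?R ** ?R = A" by (rule mat_sqrt_square[OF spd_imp_psd[OF A]])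
  have S: "?S ** ?S = ?R ** B ** ?R"
    by (intro mat_sqrt_square spd_imp_psd spd_congruence_spd mat_sqrt_spd A B)
  have "OT A B ** A ** OT A B = (?I ** ?S ** ?I) ** (?R ** ?R) ** (?I ** ?S ** ?I)"
    by (simp only: OT_eq[OF A] R)
  also have "\<dots> = ?I ** ?S ** (?I ** ?R) ** (?R ** ?I) ** ?S ** ?I"
    by (simp only: matrix_mul_assoc)
  also have "\<dots> = ?I ** (?S ** ?S) ** ?I" by (simp add: inv matrix_mul_assoc)
  also have "\<dots> = (?I ** ?R) ** B ** (?R ** ?I)" by (simp only: S matrix_mul_assoc)
  finally show ?thesis by (simp add: inv)
qed

lemma trace_OT:
  assumes A: "A \<in> spd"
  shows "trace (mat_sqrt (mat_sqrt A ** B ** mat_sqrt A)) = OT A B \<bullet> A"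
proof -
  have "trace (mat_sqrt (mat_sqrt A ** B ** mat_sqrt A)) = trace (mat_sqrt A ** (OT A B ** mat_sqrt A))"
    by (simp add: OT_sandwich[OF A, symmetric] matrix_mul_assoc)
  also have "\<dots> = trace (OT A B ** (mat_sqrt A ** mat_sqrt A))"
    by (subst trace_mul_sym) (simp add: matrix_mul_assoc)
  also have "\<dots> = trace (A ** OT A B)"
    by (simp only: mat_sqrt_square[OF spd_imp_psd[OF A]] trace_mul_sym[of A])
  finally show ?thesis
    using inner_matrix_trace[of A "OT A B"] spd_symmetric[OF A] by (simp add: inner_commute)
qed

lemma trace_mult_transpose: "trace (X ** transpose X) = X \<bullet> (X :: real^'n^'n)"
  by (simp add: inner_matrix_trace trace_mul_sym[of X])

text \<open>Completing the square. The defect on the right is what the variance inequality exploits.\<close>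

lemma young_spd:
  fixes T X Y :: "real^'n^'n"
  assumes T: "T \<in> spd"
  shows "X \<bullet> (T ** X) + Y \<bullet> (matrix_inv T ** Y) - 2 * (X \<bullet> Y)
    = (X - matrix_inv T ** Y) \<bullet> (T ** (X - matrix_inv T ** Y))"
proof -
  note inv = matrix_inv_mult[OF spd_invertible[OF T]]
  have 1: "T ** (matrix_inv T ** Y) = Y" by (simp add: inv matrix_mul_assoc)
  have 2: "(matrix_inv T ** Y) \<bullet> (T ** X) = Y \<bullet> X"
    using inner_matrix_mult_left[of T X "matrix_inv T ** Y"] spd_symmetric[OF T]
    by (simp only: 1 inner_commute)
  show ?thesis
    by (simp add: matrix_mult_distribs inner_diff_left inner_diff_right 1 2 inner_commute[of _ Y])
qed

lemma young_spd_le: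
  fixes T X Y :: "real^'n^'n"
  assumes T: "T \<in> spd"
  shows "2 * (X \<bullet> Y) \<le> X \<bullet> (T ** X) + Y \<bullet> (matrix_inv T ** Y)"
  using young_spd[OF T, of X Y] psd_inner_matrix[OF spd_imp_psd[OF T]] by (smt (verit))

lemma inner_mult_self:
  fixes M X :: "real^'n^'n"
  shows "X \<bullet> (M ** X) = M \<bullet> (X ** transpose X)"
  by (simp add: inner_commute[of X] inner_matrix_mult_right)

text \<open>Both sides are the trace of \<open>A T = T\<^bsup>-1\<^esup> B\<close>, where \<open>T\<close> is the transport map.\<close>

lemma OT_inverse_inner:
  assumes A: "A \<in> spd" and B: "B \<in> spd"
  shows "matrix_inv (OT A B) \<bullet> B = OT A B \<bullet> A"
proof -
  let ?T = "OT A B"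
  note T = OT_spd[OF A B]
  note inv = matrix_inv_mult[OF spd_invertible[OF T]]
  have "matrix_inv ?T \<bullet> (?T ** (A ** ?T)) = (transpose ?T ** matrix_inv ?T) \<bullet> (A ** ?T)"
    using inner_matrix_mult_left[of ?T "A ** ?T" "matrix_inv ?T"] by (simp add: inner_commute)
  also have "\<dots> = trace (A ** ?T)"
    by (simp add: spd_symmetric[OF T] inv inner_matrix_trace)
  also have "\<dots> = ?T \<bullet> A"
    using inner_matrix_trace[of A ?T] spd_symmetric[OF A] by (simp add: inner_commute)
  finally show ?thesis
    using OT_pushforward[OF A B] by (simp add: matrix_mul_assoc)
qed

lemma W2_square_eq_coupling:
  assumes A: "A \<in> spd" and B: "B \<in> spd"
  shows "(W2 A B)\<^sup>2 = (norm (mat_sqrt A - OT A B ** mat_sqrt A))\<^sup>2"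
    and "(W2 A B)\<^sup>2 = trace A + trace B - 2 * (OT A B \<bullet> A)"
proof -
  let ?R = "mat_sqrt A" and ?T = "OT A B"
  note R = mat_sqrt_square[OF spd_imp_psd[OF A]] spd_symmetric[OF mat_sqrt_spd[OF A]]
  note T = spd_symmetric[OF OT_spd[OF A B]]
  have "(norm (?R - ?T ** ?R))\<^sup>2 = ?R \<bullet> ?R + (?T ** ?R) \<bullet> (?T ** ?R) - 2 * (?R \<bullet> (?T ** ?R))"
    by (simp add: power2_norm_eq_inner inner_diff_left inner_diff_right inner_commute)
  also have "?R \<bullet> ?R = trace A"
    using trace_mult_transpose[of ?R] R by simp
  also have "(?T ** ?R) \<bullet> (?T ** ?R) = trace (?T ** (?R ** ?R) ** ?T)"
    by (simp only: trace_mult_transpose[of "?T ** ?R", symmetric] matrix_transpose_mul R(2) T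
        matrix_mul_assoc)
  also have "\<dots> = trace B" by (simp add: R(1) OT_pushforward[OF A B])
  also have "?R \<bullet> (?T ** ?R) = ?T \<bullet> A"
    using R by (simp add: inner_mult_self)
  finally have n: "(norm (?R - ?T ** ?R))\<^sup>2 = trace A + trace B - 2 * (?T \<bullet> A)" .
  have "trace (A + B - 2 *\<^sub>R mat_sqrt (?R ** B ** ?R)) = trace A + trace B - 2 * (?T \<bullet> A)"
    unfolding trace_OT[OF A, symmetric]
    by (simp add: trace_def sum.distrib sum_subtractf sum_distrib_left)
  then have "(W2 A B)\<^sup>2 = trace A + trace B - 2 * (?T \<bullet> A)"
    unfolding W2_def using n by (metis real_sqrt_pow2 zero_le_power2)
  then show "(W2 A B)\<^sup>2 = trace A + trace B - 2 * (?T \<bullet> A)"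
    and "(W2 A B)\<^sup>2 = (norm (?R - ?T ** ?R))\<^sup>2"
    using n by simp_all
qed

text \<open>Kantorovich duality for Gaussians: Young's inequality with the transport map \<open>T\<close> bounds the
  correlation of every coupling by \<open>trace (T A)\<close>, which the optimal coupling \<open>Y = T X\<close> attains.\<close>

lemma W2_square_le_coupling:
  fixes X Y :: "real^'n^'n"
  assumes A: "X ** transpose X \<in> spd" and B: "Y ** transpose Y \<in> spd"
  shows "(W2 (X ** transpose X) (Y ** transpose Y))\<^sup>2 \<le> (norm (X - Y))\<^sup>2"
proof -
  let ?T = "OT (X ** transpose X) (Y ** transpose Y)"
  have "2 * (X \<bullet> Y) \<le> X \<bullet> (?T ** X) + Y \<bullet> (matrix_inv ?T ** Y)"
    by (intro young_spd_le OT_spd A B)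
  also have "\<dots> = 2 * (?T \<bullet> (X ** transpose X))"
    using OT_inverse_inner[OF A B] by (simp add: inner_mult_self)
  finally have "2 * (X \<bullet> Y) \<le> 2 * (?T \<bullet> (X ** transpose X))" .
  then show ?thesis
    unfolding W2_square_eq_coupling(2)[OF A B]
    by (simp add: trace_mult_transpose power2_norm_eq_inner inner_diff_left inner_diff_right
        inner_commute)
qed

section \<open>Extreme eigenvalues and bounds on transport maps\<close>

text \<open>An eigenvector has a nonzero coefficient along some \<open>u i\<close>, and symmetry then forces its eigenvalue to
  be \<open>l i\<close>. Hence the minimum and the maximum in the definitions of the extreme eigenvalues range over
  a finite nonempty set.\<close>

lemma eigenvalues_diagonalized:
  fixes A :: "real^'n^'n"
  assumes u: "orthonormal u" and l: "\<And>i. A *v u i = l i *\<^sub>R u i"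
  shows "eigenvalues A = range l"
proof (intro equalityI subsetI)
  have A: "A = spectral_matrix u l"
    by (rule orthonormal_matrix_eqI[OF u]) (simp add: l spectral_matrix_basis[OF u])
  fix k assume "k \<in> eigenvalues A"
  then obtain v where v: "v \<noteq> 0" "A *v v = k *\<^sub>R v" by (auto simp: eigenvalues_def)
  obtain i where i: "u i \<bullet> v \<noteq> 0"
    using orthonormal_expansion(1)[OF u, of v] v(1) by (metis (no_types, lifting) scale_eq_0_iff sum.neutral)
  have "transpose A = A" by (simp add: A spectral_matrix_symmetric)
  from symmetric_inner_commute[OF this, of "u i" v] i show "k \<in> range l"
    by (simp add: v(2) l)
next
  fix k assume "k \<in> range l"
  then obtain i where "k = l i" by blast
  moreover have "u i \<noteq> 0" using u by (metis inner_zero_left orthonormal_def zero_neq_one)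
  ultimately show "k \<in> eigenvalues A" using l by (auto simp: eigenvalues_def)
qed

lemma lambda_bounds:
  fixes A :: "real^'n^'n"
  assumes "transpose A = A"
  shows lambda_min_le: "lambda_min A * (x \<bullet> x) \<le> x \<bullet> (A *v x)"
    and lambda_max_ge: "x \<bullet> (A *v x) \<le> lambda_max A * (x \<bullet> x)"
    and lambda_min_le_lambda_max: "lambda_min A \<le> lambda_max A"
    and lambda_min_eigenvalue: "lambda_min A \<in> eigenvalues A"
proof -
  obtain u l where u: "orthonormal u" and l: "\<And>i. A *v u i = l i *\<^sub>R u i"
    using symmetric_diagonalizable[OF assms] by blast
  have A: "A = spectral_matrix u l"
    by (rule orthonormal_matrix_eqI[OF u]) (simp add: l spectral_matrix_basis[OF u])
  have ev: "eigenvalues A = range l" by (rule eigenvalues_diagonalized[OF u l])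
  have b: "lambda_min A \<le> l i" "l i \<le> lambda_max A" for i
    by (simp_all add: lambda_min_def lambda_max_def ev)
  then show "lambda_min A \<le> lambda_max A" using order_trans by blast
  show "lambda_min A \<in> eigenvalues A" unfolding lambda_min_def ev by (rule Min_in) auto
  have q: "x \<bullet> (A *v x) = (\<Sum>i\<in>UNIV. l i * (u i \<bullet> x)\<^sup>2)"
    by (simp only: A spectral_matrix_quadratic_form)
  have s: "c * (x \<bullet> x) = (\<Sum>i\<in>UNIV. c * (u i \<bullet> x)\<^sup>2)" for c
    by (simp add: orthonormal_expansion(2)[OF u, of x x] sum_distrib_left power2_eq_square)
  show "lambda_min A * (x \<bullet> x) \<le> x \<bullet> (A *v x)" "x \<bullet> (A *v x) \<le> lambda_max A * (x \<bullet> x)"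
    unfolding q s by (intro sum_mono mult_right_mono b zero_le_power2)+
qed

lemma lambda_min_pos:
  assumes A: "A \<in> spd"
  shows "0 < lambda_min A"
proof -
  obtain v where v: "v \<noteq> 0" "A *v v = lambda_min A *\<^sub>R v"
    using lambda_min_eigenvalue[OF spd_symmetric[OF A]] by (auto simp: eigenvalues_def)
  then have "0 < lambda_min A * (v \<bullet> v)" using spd_pos[OF A v(1)] by simp
  then show ?thesis using v(1) by (metis inner_gt_zero_iff zero_less_mult_pos2)
qed

lemma norm_square_le_of_quadratic_form:
  fixes A :: "real^'n^'n" and c :: real
  assumes A: "transpose A = A" and c: "\<And>x. \<bar>x \<bullet> (A *v x)\<bar> \<le> c * (x \<bullet> x)"
  shows "(norm A)\<^sup>2 \<le> CARD('n) * c\<^sup>2"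
proof -
  obtain u l where u: "orthonormal u" and l: "\<And>i. A *v u i = l i *\<^sub>R u i"
    using symmetric_diagonalizable[OF A] by blast
  have uu: "u i \<bullet> u i = 1" for i using u by (simp add: orthonormal_def)
  have "\<bar>l i\<bar> \<le> c" for i using c[of "u i"] by (simp add: l uu)
  then have "(l i)\<^sup>2 \<le> c\<^sup>2" for i using power_mono[of "\<bar>l i\<bar>" c 2] by simp
  then have "(\<Sum>i\<in>UNIV. (l i)\<^sup>2) \<le> (\<Sum>i\<in>(UNIV::'n set). c\<^sup>2)" by (intro sum_mono)
  then show ?thesis
    unfolding power2_norm_eq_inner inner_matrix_orthonormal[OF u]
    by (simp add: l uu power2_eq_square)
qed

lemma norm_matrix_vector_mult_le:
  fixes K :: "real^'n^'n"
  shows "norm (K *v x) \<le> norm K * norm x"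
proof (rule power2_le_imp_le)
  have "(norm (K *v x))\<^sup>2 = (\<Sum>k\<in>UNIV. (K $ k \<bullet> x)\<^sup>2)"
    unfolding power2_norm_eq_inner
    by (simp add: inner_vec_def[of "K *v x"] matrix_vector_mul_component power2_eq_square)
  also have "\<dots> \<le> (\<Sum>k\<in>UNIV. (K $ k \<bullet> K $ k) * (x \<bullet> x))"
    by (intro sum_mono Cauchy_Schwarz_ineq)
  also have "\<dots> = (norm K * norm x)\<^sup>2"
    by (simp add: power_mult_distrib power2_norm_eq_inner inner_vec_def[of K] sum_distrib_right)
  finally show "(norm (K *v x))\<^sup>2 \<le> (norm K * norm x)\<^sup>2" .
qed simp

text \<open>With \<open>d = norm (A - B)\<close>, monotonicity of the square root applies to
  \<open>A \<le> B + d I \<le> (mat_sqrt B + sqrt d I)\<^sup>2\<close>. So the square root is 1/2-Hoelder continuous, which makes the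
  integrands below Borel measurable.\<close>

lemma mat_sqrt_close:
  fixes A B :: "real^'n^'n"
  assumes A: "A \<in> psd" and B: "B \<in> psd"
  shows "x \<bullet> (mat_sqrt A *v x) \<le> x \<bullet> (mat_sqrt B *v x) + sqrt (norm (A - B)) * (x \<bullet> x)"
proof -
  let ?d = "norm (A - B)"
  let ?H = "mat_sqrt B + sqrt ?d *\<^sub>R mat 1"
  note sB = mat_sqrt[OF B] and sA = mat_sqrt[OF A]
  have H: "?H \<in> psd"
    by (intro psd_add psd_scaleR sB spd_imp_psd[OF spd_mat[of 1, simplified]]) simp
  have "x \<bullet> ((mat_sqrt A ** mat_sqrt A) *v x) \<le> x \<bullet> ((?H ** ?H) *v x)" for x
  proof -
    have "x \<bullet> ((A - B) *v x) \<le> norm x * (?d * norm x)"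
      using norm_cauchy_schwarz[of x "(A - B) *v x"] norm_matrix_vector_mult_le[of "A - B" x]
      by (smt (verit) mult_left_mono norm_ge_zero)
    then have le: "x \<bullet> (A *v x) \<le> x \<bullet> (B *v x) + ?d * (x \<bullet> x)"
      by (simp add: algebra_simps power2_eq_square flip: power2_norm_eq_inner)
    have "?H *v x = mat_sqrt B *v x + sqrt ?d *\<^sub>R x"
      by (simp add: algebra_simps flip: scaleR_matrix_vector_assoc)
    then have "x \<bullet> ((?H ** ?H) *v x)
        = (mat_sqrt B *v x + sqrt ?d *\<^sub>R x) \<bullet> (mat_sqrt B *v x + sqrt ?d *\<^sub>R x)"
      using symmetric_inner_commute[OF psd_symmetric[OF H], of x "?H *v x"]
      by (simp flip: matrix_vector_mul_assoc)
    moreover have "(mat_sqrt B *v x) \<bullet> (mat_sqrt B *v x) = x \<bullet> (B *v x)"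
      using symmetric_inner_commute[OF psd_symmetric[OF sB(1)], of x "mat_sqrt B *v x"]
      by (simp add: matrix_vector_mul_assoc sB(2))
    ultimately have "x \<bullet> ((?H ** ?H) *v x)
        = x \<bullet> (B *v x) + 2 * sqrt ?d * (x \<bullet> (mat_sqrt B *v x)) + ?d * (x \<bullet> x)"
      by (simp add: inner_add_left inner_add_right inner_commute)
    moreover have "0 \<le> 2 * sqrt ?d * (x \<bullet> (mat_sqrt B *v x))"
      using psd_nonneg[OF sB(1)] by simp
    ultimately show ?thesis using le by (simp add: sA(2))
  qed
  from psd_sqrt_mono[OF H sA(1) this, of x] show ?thesis
    by (simp add: algebra_simps flip: scaleR_matrix_vector_assoc)
qed

lemma continuous_on_mat_sqrt: "continuous_on psd (mat_sqrt :: real^'n^'n \<Rightarrow> _)"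
proof -
  have le: "(dist (mat_sqrt A) (mat_sqrt B))\<^sup>2 \<le> CARD('n) * dist A B" 
    if "A \<in> psd" "B \<in> psd" for A B :: "real^'n^'n"
  proof -
    have "\<bar>x \<bullet> ((mat_sqrt A - mat_sqrt B) *v x)\<bar> \<le> sqrt (norm (A - B)) * (x \<bullet> x)" for x
      using mat_sqrt_close[OF that, of x] mat_sqrt_close[OF that(2,1), of x]
      by (simp add: algebra_simps norm_minus_commute abs_le_iff)
    moreover have "transpose (mat_sqrt A - mat_sqrt B) = mat_sqrt A - mat_sqrt B"
      using psd_symmetric mat_sqrt_psd that by (metis transpose_distribs(2))
    ultimately have "(norm (mat_sqrt A - mat_sqrt B))\<^sup>2 \<le> CARD('n) * (sqrt (norm (A - B)))\<^sup>2"
      by (intro norm_square_le_of_quadratic_form)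
    then show ?thesis by (simp add: dist_norm)
  qed
  show ?thesis
  proof (rule continuous_onI, goal_cases)
    case (1 A e)
    show ?case
    proof (intro exI conjI ballI impI)
      show "0 < e\<^sup>2 / (2 * CARD('n))" using 1 by simp
      fix B :: "real^'n^'n" assume B: "B \<in> psd" "dist B A < e\<^sup>2 / (2 * CARD('n))"
      then have "CARD('n) * (2 * dist B A) < e\<^sup>2" by (simp add: field_simps)
      moreover have "0 \<le> CARD('n) * dist B A" by simp
      ultimately have "CARD('n) * dist B A \<le> e\<^sup>2" by linarith
      then have "(dist (mat_sqrt B) (mat_sqrt A))\<^sup>2 \<le> e\<^sup>2" using le[OF B(1) 1(2)] by linarith
      then show "dist (mat_sqrt B) (mat_sqrt A) \<le> e"
        using 1(1) by (rule power2_le_imp_le[OF _ less_imp_le])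
    qed
  qed
qed

lemma continuous_on_congruence:
  "continuous_on X (\<lambda>B. (C :: real^'n^'n) ** B ** (D :: real^'n^'n))"
  by (intro bounded_bilinear.continuous_on[OF bounded_bilinear_matrix_mult] continuous_intros)

text \<open>With \<open>R = mat_sqrt A\<close>, the matrix \<open>R T R\<close> is the square root of \<open>R B R \<ge> lambda_min B R\<^sup>2\<close>. The resulting
  bound \<open>T \<ge> sqrt (lambda_min B) A\<^bsup>-1/2\<^esup>\<close> grows as \<open>A\<close> degenerates, and this is what later keeps the
  gradient away from zero near singular matrices.\<close>

lemma OT_ge_mat_sqrt_inverse:
  assumes A: "A \<in> spd" and B: "B \<in> spd"
  shows "sqrt (lambda_min B) * (x \<bullet> (mat_sqrt A *v x))
    \<le> x \<bullet> ((mat_sqrt A ** OT A B ** mat_sqrt A) *v x)"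
proof -
  let ?R = "mat_sqrt A" and ?l = "lambda_min B"
  have l: "0 \<le> ?l" using lambda_min_pos[OF B] by simp
  have R: "?R \<in> psd" by (rule mat_sqrt_psd[OF spd_imp_psd[OF A]])
  note symR = symmetric_inner_commute[OF psd_symmetric[OF R]]
  have C: "?R ** B ** ?R \<in> psd"
    by (intro spd_imp_psd spd_congruence_spd mat_sqrt_spd A B)
  have "x \<bullet> ((sqrt ?l *\<^sub>R ?R ** (sqrt ?l *\<^sub>R ?R)) *v x)
      \<le> x \<bullet> ((mat_sqrt (?R ** B ** ?R) ** mat_sqrt (?R ** B ** ?R)) *v x)" for x
    using lambda_min_le[OF spd_symmetric[OF B], of "?R *v x"] l
    by (simp add: mat_sqrt_square[OF C] matrix_mult_distribs symR flip: matrix_vector_mul_assoc scaleR_matrix_vector_assoc)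
  from psd_sqrt_mono[OF mat_sqrt_psd[OF C] psd_scaleR[OF R] this, of x] l
  show ?thesis
    by (simp add: OT_sandwich[OF A] flip: scaleR_matrix_vector_assoc)
qed

text \<open>Here \<open>L T\<^sup>2 \<ge> T A T = B \<ge> lambda_min B I\<close>.\<close>

lemma OT_ge_scaled_identity:
  assumes A: "A \<in> spd" and B: "B \<in> spd" and L: "0 < L" "\<And>x. x \<bullet> (A *v x) \<le> L * (x \<bullet> x)"
  shows "sqrt (lambda_min B / L) * (x \<bullet> x) \<le> x \<bullet> (OT A B *v x)"
proof -
  let ?T = "OT A B"
  define c where "c = sqrt (lambda_min B / L)"
  have c: "0 \<le> c" "c * c = lambda_min B / L"
    using lambda_min_pos[OF B] L(1) by (simp_all add: c_def)
  note T = OT_spd[OF A B]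
  note symT = symmetric_inner_commute[OF spd_symmetric[OF T]]
  have sq: "x \<bullet> ((c *\<^sub>R mat 1 ** (c *\<^sub>R mat 1)) *v x) \<le> x \<bullet> ((?T ** ?T) *v x)" for x
  proof -
    have "lambda_min B * (x \<bullet> x) \<le> x \<bullet> ((?T ** A ** ?T) *v x)"
      using lambda_min_le[OF spd_symmetric[OF B], of x] OT_pushforward[OF A B] by simp
    also have "\<dots> = (?T *v x) \<bullet> (A *v (?T *v x))"
      by (simp add: symT flip: matrix_vector_mul_assoc)
    also have "\<dots> \<le> L * ((?T *v x) \<bullet> (?T *v x))" by (rule L(2))
    finally have "lambda_min B / L * (x \<bullet> x) \<le> (?T *v x) \<bullet> (?T *v x)"
      using L(1) by (simp add: field_simps)
    then show ?thesis
      by (simp add: c(2) matrix_mult_distribs symT flip: matrix_vector_mul_assoc scaleR_matrix_vector_assoc)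
  qed
  have "c *\<^sub>R mat 1 \<in> psd"
    using psd_scaleR[OF spd_imp_psd[OF spd_mat[of 1]] c(1)] by simp
  from psd_sqrt_mono[OF spd_imp_psd[OF T] this sq, of x] show ?thesis by (simp add: c_def flip: scaleR_matrix_vector_assoc)
qed

section \<open>Integrability under averaged conditioning\<close>

locale averaged_conditioning = prob_space P for P :: "(real^'n^'n) measure" +
  assumes sets_P: "sets P = sets (restrict_space borel spd)"
    and norm_lambda_min_half_pos: "0 < norm_lambda_min_half P"
    and integrable_lambda_max: "integrable P lambda_max"
begin

lemma space_P: "space P = spd"
  using sets_eq_imp_space_eq[OF sets_P] by (simp add: space_restrict_space)

lemma measurable_continuous_on_spd:
  "continuous_on spd f \<Longrightarrow> f \<in> borel_measurable P"
  using borel_measurable_continuous_on_restrict measurable_cong_sets[OF sets_P refl] by blast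

lemma lambda_max_pos: "B \<in> spd \<Longrightarrow> 0 < lambda_max B"
  using lambda_min_pos lambda_min_le_lambda_max spd_symmetric by (metis less_le_trans)

abbreviation "mean_sqrt_lambda_min \<equiv> \<integral>B. sqrt (lambda_min B) \<partial>P"

abbreviation "mean_lambda_max \<equiv> norm_lambda_max_one P"

text \<open>A nonzero Bochner integral can only come from an integrable function.\<close>

lemma integrable_sqrt_lambda_min: "integrable P (\<lambda>B. sqrt (lambda_min B))"
  using norm_lambda_min_half_pos not_integrable_integral_eq
  by (fastforce simp: norm_lambda_min_half_def)

lemma mean_sqrt_lambda_min_pos: "0 < mean_sqrt_lambda_min"
proof -
  have "0 \<le> mean_sqrt_lambda_min"
    using lambda_min_pos[THEN less_imp_le] space_P by (intro integral_nonneg_AE AE_I2) auto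
  moreover have "mean_sqrt_lambda_min \<noteq> 0"
    using norm_lambda_min_half_pos by (auto simp: norm_lambda_min_half_def)
  ultimately show ?thesis by simp
qed

lemma integrable_sqrt_lambda_max: "integrable P (\<lambda>B. sqrt (lambda_max B))"
proof (rule Bochner_Integration.integrable_bound)
  show "integrable P (\<lambda>B. 1 + lambda_max B)" using integrable_lambda_max by simp
  show "(\<lambda>B. sqrt (lambda_max B)) \<in> borel_measurable P"
    using integrable_lambda_max by measurable
  have "norm (sqrt y) \<le> norm (1 + y)" if "0 < y" for y :: real
  proof -
    have "sqrt y \<le> 1 + y"
      using that by (intro real_le_lsqrt) (auto simp: power2_eq_square algebra_simps)
    then show ?thesis using that by simp
  qed
  then show "AE B in P. norm (sqrt (lambda_max B)) \<le> norm (1 + lambda_max B)"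
    by (intro AE_I2) (metis lambda_max_pos space_P)
qed

text \<open>The variance of \<open>sqrt lambda_max\<close> is nonnegative.\<close>

lemma mean_sqrt_lambda_max_square_le: "(\<integral>B. sqrt (lambda_max B) \<partial>P)\<^sup>2 \<le> mean_lambda_max"
proof -
  have sq: "(sqrt (lambda_max B))\<^sup>2 = lambda_max B" if "B \<in> space P" for B
    using lambda_max_pos[of B] that by (simp add: space_P)
  have eq: "(\<integral>B. (sqrt (lambda_max B))\<^sup>2 \<partial>P) = mean_lambda_max"
    unfolding norm_lambda_max_one_def by (rule Bochner_Integration.integral_cong[OF refl sq])
  have "integrable P (\<lambda>B. (sqrt (lambda_max B))\<^sup>2)"
    by (rule Bochner_Integration.integrable_cong[OF refl sq, THEN iffD2, OF _ integrable_lambda_max])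
  then have "variance (\<lambda>B. sqrt (lambda_max B)) = mean_lambda_max - (\<integral>B. sqrt (lambda_max B) \<partial>P)\<^sup>2"
    using variance_eq[OF integrable_sqrt_lambda_max] eq by simp
  then show ?thesis using variance_positive[of "\<lambda>B. sqrt (lambda_max B)"] by linarith
qed

lemma norm_lambda_min_half_le: "norm_lambda_min_half P \<le> mean_lambda_max"
proof -
  have "mean_sqrt_lambda_min \<le> (\<integral>B. sqrt (lambda_max B) \<partial>P)"
    using lambda_min_le_lambda_max spd_symmetric
    by (intro integral_mono integrable_sqrt_lambda_min integrable_sqrt_lambda_max)
      (auto simp: space_P)
  then show ?thesis
    using mean_sqrt_lambda_max_square_le mean_sqrt_lambda_min_pos
    unfolding norm_lambda_min_half_def by (smt (verit) power_mono)
qed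

lemma mean_lambda_max_pos: "0 < mean_lambda_max"
  using norm_lambda_min_half_le norm_lambda_min_half_pos by linarith

lemma kappa_bar_ge_1: "1 \<le> kappa_bar P"
  using norm_lambda_min_half_le norm_lambda_min_half_pos by (simp add: kappa_bar_def)

lemma integrable_matrix: "integrable P (\<lambda>B. B)"
proof (rule Bochner_Integration.integrable_bound)
  show "integrable P (\<lambda>B. sqrt CARD('n) * lambda_max B)" using integrable_lambda_max by simp
  show "(\<lambda>B. B) \<in> borel_measurable P"
    by (intro measurable_continuous_on_spd continuous_on_id)
  show "AE B in P. norm B \<le> norm (sqrt CARD('n) * lambda_max B)"
  proof (rule AE_I2, unfold space_P)
    fix B :: "real^'n^'n" assume B: "B \<in> spd"
    note pos = lambda_max_pos[OF B]
    have "(norm B)\<^sup>2 \<le> CARD('n) * (lambda_max B)\<^sup>2"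
      using psd_nonneg[OF spd_imp_psd[OF B]] lambda_max_ge[OF spd_symmetric[OF B]]
      by (intro norm_square_le_of_quadratic_form spd_symmetric[OF B]) simp
    also have "\<dots> = (sqrt CARD('n) * lambda_max B)\<^sup>2" by (simp add: power_mult_distrib)
    finally have "norm B \<le> sqrt CARD('n) * lambda_max B"
      by (rule power2_le_imp_le) (use pos in simp)
    then show "norm B \<le> norm (sqrt CARD('n) * lambda_max B)" using pos by (simp add: abs_mult)
  qed
qed

text \<open>The squared norm of \<open>mat_sqrt (R B R)\<close> is \<open>trace (R B R) = A \<bullet> B\<close>, so the transport map grows at most
  linearly in \<open>B\<close>, which is integrable.\<close>

lemma integrable_OT:
  assumes A: "A \<in> spd"
  shows "integrable P (OT A)"
proof -
  let ?R = "mat_sqrt A"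
  have R: "?R ** ?R = A" "transpose ?R = ?R"
    using mat_sqrt_square[OF spd_imp_psd[OF A]] spd_symmetric[OF mat_sqrt_spd[OF A]] by auto
  have 1: "integrable P (\<lambda>B. mat_sqrt (?R ** B ** ?R))"
  proof (rule Bochner_Integration.integrable_bound)
    show "integrable P (\<lambda>B. 1 + norm A * norm B)" using integrable_matrix by simp
    show "(\<lambda>B. mat_sqrt (?R ** B ** ?R)) \<in> borel_measurable P"
    proof (intro measurable_continuous_on_spd
        continuous_on_compose2[OF continuous_on_mat_sqrt continuous_on_congruence])
      show "(\<lambda>B. ?R ** B ** ?R) ` spd \<subseteq> psd"
        using spd_congruence_spd[OF _ mat_sqrt_spd[OF A]] spd_imp_psd by blast
    qed
    show "AE B in P. norm (mat_sqrt (?R ** B ** ?R)) \<le> norm (1 + norm A * norm B)"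
    proof (rule AE_I2, unfold space_P)
      fix B :: "real^'n^'n" assume B: "B \<in> spd"
      let ?S = "mat_sqrt (?R ** B ** ?R)"
      have C: "?R ** B ** ?R \<in> psd" by (intro spd_imp_psd spd_congruence_spd mat_sqrt_spd A B)
      have "(norm ?S)\<^sup>2 = trace (?S ** ?S)"
        using trace_mult_transpose[of ?S] psd_symmetric[OF mat_sqrt_psd[OF C]]
        by (simp add: power2_norm_eq_inner)
      also have "\<dots> = trace (?R ** (?R ** B))"
        by (simp add: mat_sqrt_square[OF C]) (rule trace_mul_sym)
      also have "\<dots> = A \<bullet> B"
        using spd_symmetric[OF A] by (simp add: inner_matrix_trace matrix_mul_assoc R)
      also have "\<dots> \<le> norm A * norm B" by (rule norm_cauchy_schwarz)
      finally have "(norm ?S)\<^sup>2 \<le> norm A * norm B" .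
      moreover have "norm ?S \<le> 1 + (norm ?S)\<^sup>2"
        using zero_le_power2[of "norm ?S - 1"] norm_ge_zero[of ?S]
        unfolding power2_diff one_power2 by linarith
      ultimately show "norm ?S \<le> norm (1 + norm A * norm B)" by simp
    qed
  qed
  have "bounded_linear (\<lambda>S. matrix_inv ?R ** S ** matrix_inv ?R)"
    by (intro bounded_linear_compose[OF bounded_bilinear.bounded_linear_left[OF bounded_bilinear_matrix_mult]]
        bounded_bilinear.bounded_linear_right[OF bounded_bilinear_matrix_mult])
  from integrable_bounded_linear[OF this 1] show ?thesis
    by (simp add: OT_eq[OF A, abs_def])
qed

end

section \<open>The barycenter functional along a gradient step\<close>

lemma bounded_linear_quadratic_form: "bounded_linear (\<lambda>M. x \<bullet> ((M :: real^'n^'n) *v x))"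
proof -
  have "linear (\<lambda>M. x \<bullet> ((M :: real^'n^'n) *v x))"
    by (rule linearI) (simp_all add: algebra_simps flip: scaleR_matrix_vector_assoc)
  then show ?thesis by (simp add: linear_conv_bounded_linear)
qed

lemma mat_1_inner: "mat 1 \<bullet> (A :: real^'n^'n) = trace A"
  by (simp add: inner_matrix_trace)

lemma bounded_linear_trace: "bounded_linear (trace :: real^'n^'n \<Rightarrow> real)"
  using bounded_linear_inner_right[of "mat 1 :: real^'n^'n"] by (simp add: mat_1_inner)

lemma spd_eq_coupling_square:
  assumes "A \<in> spd"
  shows "mat_sqrt A ** transpose (mat_sqrt A) = A"
  using assms by (simp add: mat_sqrt_square spd_imp_psd spd_symmetric mat_sqrt_spd)

lemma mult_mult_transpose:
  fixes K X :: "real^'n^'n"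
  shows "(K ** X) ** transpose (K ** X) = K ** (X ** transpose X) ** transpose K"
  by (simp only: matrix_transpose_mul matrix_mul_assoc)

context averaged_conditioning
begin

text \<open>The Riemannian gradient of the barycenter functional at \<open>A\<close> is \<open>mat 1 - avg_OT A\<close>.\<close>

definition avg_OT :: "real^'n^'n \<Rightarrow> real^'n^'n" where
  "avg_OT A = (\<integral>B. OT A B \<partial>P)"

lemma integrable_trace: "integrable P trace"
  by (rule integrable_bounded_linear[OF bounded_linear_trace integrable_matrix])

lemma integrable_OT_inner: "A \<in> spd \<Longrightarrow> integrable P (\<lambda>B. OT A B \<bullet> C)"
  using integrable_OT by simp

lemma integral_OT_inner: "A \<in> spd \<Longrightarrow> (\<integral>B. OT A B \<bullet> C \<partial>P) = avg_OT A \<bullet> C"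
  using integrable_OT by (simp add: avg_OT_def)

lemma integrable_OT_form: "A \<in> spd \<Longrightarrow> integrable P (\<lambda>B. x \<bullet> (OT A B *v x))"
  by (rule integrable_bounded_linear[OF bounded_linear_quadratic_form integrable_OT])

lemma integral_OT_form: "A \<in> spd \<Longrightarrow> (\<integral>B. x \<bullet> (OT A B *v x) \<partial>P) = x \<bullet> (avg_OT A *v x)"
  unfolding avg_OT_def by (rule integral_bounded_linear[OF bounded_linear_quadratic_form integrable_OT])

lemma avg_OT_psd:
  assumes A: "A \<in> spd"
  shows "avg_OT A \<in> psd"
proof -
  have "transpose (avg_OT A) = (\<integral>B. transpose (OT A B) \<partial>P)"
    unfolding avg_OT_def by (rule integral_bounded_linear[OF bounded_linear_transpose integrable_OT[OF A], symmetric])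
  also have "\<dots> = avg_OT A"
    unfolding avg_OT_def
    by (intro Bochner_Integration.integral_cong refl spd_symmetric OT_spd A) (simp add: space_P)
  finally have "transpose (avg_OT A) = avg_OT A" .
  moreover have "0 \<le> x \<bullet> (avg_OT A *v x)" for x
    unfolding integral_OT_form[OF A, symmetric]
    using psd_nonneg[OF spd_imp_psd[OF OT_spd[OF A]]]
    by (intro integral_nonneg_AE AE_I2) (simp add: space_P)
  ultimately show ?thesis by (simp add: psd_def)
qed

lemma integrable_W2_square:
  assumes A: "A \<in> spd"
  shows "integrable P (\<lambda>B. (W2 A B)\<^sup>2)"
proof -
  have "integrable P (\<lambda>B. trace A + trace B - 2 * (OT A B \<bullet> A))"
    using integrable_trace integrable_OT_inner[OF A] by simp
  moreover have "(W2 A B)\<^sup>2 = trace A + trace B - 2 * (OT A B \<bullet> A)" if "B \<in> space P" for B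
    using that by (intro W2_square_eq_coupling A) (simp add: space_P)
  ultimately show ?thesis
    by (subst Bochner_Integration.integrable_cong[OF refl])
qed

lemma bary_F_eq:
  assumes A: "A \<in> spd"
  shows "2 * bary_F P A = trace A + (\<integral>B. trace B \<partial>P) - 2 * (avg_OT A \<bullet> A)"
proof -
  have "2 * bary_F P A = (\<integral>B. (W2 A B)\<^sup>2 \<partial>P)" by (simp add: bary_F_def)
  also have "\<dots> = (\<integral>B. trace A + trace B - 2 * (OT A B \<bullet> A) \<partial>P)"
    by (intro Bochner_Integration.integral_cong refl W2_square_eq_coupling A) (simp add: space_P)
  also have "\<dots> = trace A + (\<integral>B. trace B \<partial>P) - 2 * (avg_OT A \<bullet> A)"
    using integrable_trace integrable_OT_inner[OF A]
    by (simp add: integral_OT_inner[OF A] prob_space)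
  finally show ?thesis .
qed

text \<open>The squared norm of the Riemannian gradient \<open>mat 1 - avg_OT A\<close> in \<open>L\<^sup>2\<close> of the Gaussian with covariance
  \<open>A\<close>.\<close>

definition gradient_norm_sq :: "real^'n^'n \<Rightarrow> real" where
  "gradient_norm_sq A = (norm ((mat 1 - avg_OT A) ** mat_sqrt A))\<^sup>2"

text \<open>Smoothness of the functional: moving \<open>A\<close> by \<open>S\<close> while keeping, for each \<open>B\<close>, the coupling
  \<open>(S X, T\<^sub>B X)\<close> of the new point with \<open>B\<close> can only overestimate the new distances, and the resulting
  upper bound is an explicit quadratic in the step size.\<close>

lemma gradient_step_decrease:
  assumes A: "A \<in> spd" and \<eta>: "0 < \<eta>" "\<eta> < 1"
  defines "S \<equiv> (1 - \<eta>) *\<^sub>R mat 1 + \<eta> *\<^sub>R avg_OT A"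
  shows "S ** A ** S \<in> spd"
    and "bary_F P (S ** A ** S) \<le> bary_F P A - (\<eta> - \<eta>\<^sup>2 / 2) * gradient_norm_sq A"
proof -
  let ?R = "mat_sqrt A" and ?M = "avg_OT A"
  have S: "S \<in> spd"
    unfolding S_def using \<eta> by (intro spd_add_psd spd_mat psd_scaleR avg_OT_psd A) auto
  show SAS: "S ** A ** S \<in> spd" by (intro spd_congruence_spd A S)
  note RR = spd_eq_coupling_square[OF A]
  have cS: "(S ** ?R) ** transpose (S ** ?R) = S ** A ** S"
    by (simp only: mult_mult_transpose RR spd_symmetric[OF S])
  have "2 * bary_F P (S ** A ** S) = (\<integral>B. (W2 (S ** A ** S) B)\<^sup>2 \<partial>P)"
    by (simp add: bary_F_def)
  also have "\<dots> \<le> (\<integral>B. (norm (S ** ?R))\<^sup>2 + trace B - 2 * (OT A B \<bullet> (S ** A)) \<partial>P)"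
  proof (intro integral_mono integrable_W2_square SAS)
    show "integrable P (\<lambda>B. (norm (S ** ?R))\<^sup>2 + trace B - 2 * (OT A B \<bullet> (S ** A)))"
      using integrable_trace integrable_OT_inner[OF A] by simp
    fix B assume "B \<in> space P"
    then have B: "B \<in> spd" by (simp add: space_P)
    let ?T = "OT A B"
    have cT: "(?T ** ?R) ** transpose (?T ** ?R) = B"
      by (simp only: mult_mult_transpose RR OT_pushforward[OF A B] spd_symmetric[OF OT_spd[OF A B]])
    have "(W2 (S ** A ** S) B)\<^sup>2 \<le> (norm (S ** ?R - ?T ** ?R))\<^sup>2"
      using W2_square_le_coupling[of "S ** ?R" "?T ** ?R"] SAS B by (simp only: cS cT)
    also have "\<dots> = (norm (S ** ?R))\<^sup>2 + (?T ** ?R) \<bullet> (?T ** ?R) - 2 * ((?T ** ?R) \<bullet> (S ** ?R))"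
      by (simp add: power2_norm_eq_inner inner_diff_left inner_diff_right inner_commute)
    also have "(?T ** ?R) \<bullet> (?T ** ?R) = trace B"
      by (simp only: trace_mult_transpose[symmetric] cT)
    also have "(?T ** ?R) \<bullet> (S ** ?R) = ?T \<bullet> (S ** A)"
      by (simp only: inner_matrix_mult_right matrix_mul_assoc[symmetric] RR)
    finally show "(W2 (S ** A ** S) B)\<^sup>2 \<le> (norm (S ** ?R))\<^sup>2 + trace B - 2 * (?T \<bullet> (S ** A))" .
  qed
  also have "\<dots> = (norm (S ** ?R))\<^sup>2 + (\<integral>B. trace B \<partial>P) - 2 * (?M \<bullet> (S ** A))"
    using integrable_trace integrable_OT_inner[OF A]
    by (simp add: integral_OT_inner[OF A] prob_space)
  also have "?M \<bullet> (S ** A) = (?M ** ?R) \<bullet> (S ** ?R)"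
    by (simp only: inner_matrix_mult_right matrix_mul_assoc[symmetric] RR)
  finally have le: "2 * bary_F P (S ** A ** S)
      \<le> (norm (S ** ?R))\<^sup>2 + (\<integral>B. trace B \<partial>P) - 2 * ((?M ** ?R) \<bullet> (S ** ?R))" .
  have trA: "trace A = ?R \<bullet> ?R" by (simp only: trace_mult_transpose[symmetric] RR)
  have MA: "?M \<bullet> A = (?M ** ?R) \<bullet> ?R" by (simp only: inner_matrix_mult_right RR)
  define g where "g = (mat 1 - ?M) ** ?R"
  have M: "?M ** ?R = ?R - g" by (simp add: g_def matrix_mult_distribs)
  have SR: "S ** ?R = ?R - \<eta> *\<^sub>R g"
    by (simp add: g_def S_def matrix_mult_distribs algebra_simps)
  have "(norm (S ** ?R))\<^sup>2 - 2 * ((?M ** ?R) \<bullet> (S ** ?R))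
      = trace A - 2 * (?M \<bullet> A) - (2 * \<eta> - \<eta>\<^sup>2) * (g \<bullet> g)"
    unfolding MA trA M SR power2_norm_eq_inner
    by (simp add: inner_diff_left inner_diff_right inner_commute power2_eq_square algebra_simps)
  with le bary_F_eq[OF A]
  show "bary_F P (S ** A ** S) \<le> bary_F P A - (\<eta> - \<eta>\<^sup>2 / 2) * gradient_norm_sq A"
    by (simp add: gradient_norm_sq_def g_def[symmetric] power2_norm_eq_inner algebra_simps)
qed

end

section \<open>The barycenter and the variance inequality\<close>

locale barycenter_problem = averaged_conditioning P for P :: "(real^'n^'n) measure" +
  fixes C :: "real^'n^'n"
  assumes barycenter: "is_barycenter P C"
begin

lemma barycenter_spd: "C \<in> spd"
  and barycenter_le: "A \<in> spd \<Longrightarrow> bary_F P C \<le> bary_F P A"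
  using barycenter by (auto simp: is_barycenter_def is_arg_min_def not_less)

text \<open>First-order optimality: a gradient step from the minimizer cannot decrease the functional, so its
  gradient vanishes. Step size \<open>1/2\<close> is one choice that stays inside the positive definite matrices.\<close>

lemma avg_OT_barycenter: "avg_OT C = mat 1"
proof -
  let ?R = "mat_sqrt C"
  have "(3/8) * gradient_norm_sq C \<le> 0"
    using gradient_step_decrease[OF barycenter_spd, of "1/2"] barycenter_le
    by (fastforce simp: power2_eq_square)
  then have "(mat 1 - avg_OT C) ** ?R = 0" by (simp add: gradient_norm_sq_def)
  then have "(mat 1 - avg_OT C) ** (?R ** matrix_inv ?R) = 0" by (simp add: matrix_mul_assoc)
  then show ?thesis
    by (simp add: matrix_inv_mult[OF spd_invertible[OF mat_sqrt_spd[OF barycenter_spd]]])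
qed

text \<open>Optimality turns \<open>q = x \<bullet> C x\<close> into the average of \<open>x \<bullet> mat_sqrt (R B R) x\<close> with \<open>R = mat_sqrt C\<close>. By
  Cauchy--Schwarz each term is at most \<open>norm x sqrt (lambda_max B q)\<close>, and dividing by \<open>sqrt q\<close> bounds \<open>q\<close>.\<close>

lemma barycenter_le_mean_lambda_max: "x \<bullet> (C *v x) \<le> mean_lambda_max * (x \<bullet> x)"
proof (cases "x = 0")
  case False
  let ?R = "mat_sqrt C" and ?q = "x \<bullet> (C *v x)" and ?m = "\<integral>B. sqrt (lambda_max B) \<partial>P"
  note R = mat_sqrt_square[OF spd_imp_psd[OF barycenter_spd]] mat_sqrt_spd[OF barycenter_spd]
  note symR = symmetric_inner_commute[OF spd_symmetric[OF R(2)]]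
  have q: "0 < ?q" by (rule spd_pos[OF barycenter_spd False])
  have qR: "?q = (?R *v x) \<bullet> (?R *v x)"
    using symR[of x "?R *v x"] by (simp add: matrix_vector_mul_assoc R(1))
  have "?q = (\<integral>B. (?R *v x) \<bullet> (OT C B *v (?R *v x)) \<partial>P)"
    by (simp add: integral_OT_form[OF barycenter_spd] avg_OT_barycenter qR)
  also have "\<dots> \<le> (\<integral>B. norm x * sqrt ?q * sqrt (lambda_max B) \<partial>P)"
  proof (intro integral_mono integrable_OT_form barycenter_spd)
    show "integrable P (\<lambda>B. norm x * sqrt ?q * sqrt (lambda_max B))"
      using integrable_sqrt_lambda_max by simp
    fix B assume "B \<in> space P"
    then have B: "B \<in> spd" by (simp add: space_P)
    let ?H = "mat_sqrt (?R ** B ** ?R)"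
    have RBR: "?R ** B ** ?R \<in> psd" by (intro spd_imp_psd spd_congruence_spd R B)
    note H = mat_sqrt[OF RBR]
    have "(norm (?H *v x))\<^sup>2 = x \<bullet> ((?R ** B ** ?R) *v x)"
      using symmetric_inner_commute[OF psd_symmetric[OF H(1)], of x "?H *v x"]
      by (simp add: power2_norm_eq_inner matrix_vector_mul_assoc H(2))
    also have "\<dots> = (?R *v x) \<bullet> (B *v (?R *v x))"
      by (simp add: symR flip: matrix_vector_mul_assoc)
    also have "\<dots> \<le> lambda_max B * ?q"
      unfolding qR by (rule lambda_max_ge[OF spd_symmetric[OF B]])
    finally have Hx: "norm (?H *v x) \<le> sqrt (lambda_max B * ?q)" by (rule real_le_rsqrt)
    have "(?R *v x) \<bullet> (OT C B *v (?R *v x)) = x \<bullet> (?H *v x)"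
      by (simp only: OT_sandwich[OF barycenter_spd, symmetric] symR matrix_vector_mul_assoc[symmetric])
    also have "\<dots> \<le> norm x * norm (?H *v x)" by (rule norm_cauchy_schwarz)
    also have "\<dots> \<le> norm x * sqrt (lambda_max B * ?q)" by (intro mult_left_mono Hx) simp
    finally show "(?R *v x) \<bullet> (OT C B *v (?R *v x)) \<le> norm x * sqrt ?q * sqrt (lambda_max B)"
      by (simp add: real_sqrt_mult mult_ac)
  qed
  also have "\<dots> = norm x * ?m * sqrt ?q" by simp
  finally have "sqrt ?q * sqrt ?q \<le> norm x * ?m * sqrt ?q" using q by simp
  then have "sqrt ?q \<le> norm x * ?m"
    by (rule mult_right_le_imp_le) (use q in simp)
  then have "?q \<le> (norm x * ?m)\<^sup>2" using q sqrt_le_D by blast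
  also have "\<dots> = ?m\<^sup>2 * (x \<bullet> x)" by (simp add: power_mult_distrib power2_norm_eq_inner)
  also have "\<dots> \<le> mean_lambda_max * (x \<bullet> x)"
    by (intro mult_right_mono mean_sqrt_lambda_max_square_le) simp
  finally show ?thesis .
qed simp

lemma sqrt_kappa_bar: "mean_sqrt_lambda_min / sqrt mean_lambda_max = 1 / sqrt (kappa_bar P)"
  using mean_sqrt_lambda_min_pos
  by (simp add: kappa_bar_def norm_lambda_min_half_def real_sqrt_divide)

text \<open>For each \<open>B\<close>, testing duality for the pair \<open>(A, B)\<close> with the transport map \<open>T\<close> from \<open>C\<close> to \<open>B\<close> leaves the
  defect \<open>(X - Z) \<bullet> T (X - Z)\<close>, where \<open>Z\<close> is the optimal partner of \<open>X\<close> in \<open>B\<close> pulled back to \<open>C\<close>. This is at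
  least \<open>sqrt (lambda_min B / mean_lambda_max)\<close> times a coupling cost between \<open>A\<close> and \<open>C\<close>. On average the
  remaining terms give the optimal value, because \<open>T\<close> averages to the identity.\<close>

theorem variance_inequality:
  assumes A: "A \<in> spd"
  shows "(W2 A C)\<^sup>2 / (2 * sqrt (kappa_bar P)) \<le> bary_F P A - bary_F P C"
proof -
  let ?X = "mat_sqrt A" and ?w = "(W2 A C)\<^sup>2" and ?L = mean_lambda_max
  note C = barycenter_spd
  have XX: "?X ** transpose ?X = A" by (rule spd_eq_coupling_square[OF A])
  have "(\<integral>B. trace A + trace B - OT C B \<bullet> A - OT C B \<bullet> C + sqrt (lambda_min B) * (?w / sqrt ?L) \<partial>P)
      \<le> (\<integral>B. (W2 A B)\<^sup>2 \<partial>P)"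
  proof (intro integral_mono integrable_W2_square A)
    show "integrable P (\<lambda>B. trace A + trace B - OT C B \<bullet> A - OT C B \<bullet> C
        + sqrt (lambda_min B) * (?w / sqrt ?L))"
      using integrable_trace integrable_OT_inner[OF C] integrable_sqrt_lambda_min by simp
    fix B assume "B \<in> space P"
    then have B: "B \<in> spd" by (simp add: space_P)
    let ?T = "OT C B" and ?Y = "OT A B ** ?X" and ?c = "sqrt (lambda_min B / ?L)"
    let ?Z = "matrix_inv ?T ** ?Y"
    note T = OT_spd[OF C B]
    note inv = matrix_inv_mult[OF spd_invertible[OF T]]
    have YY: "?Y ** transpose ?Y = B"
      by (simp only: mult_mult_transpose XX OT_pushforward[OF A B] spd_symmetric[OF OT_spd[OF A B]])
    have "?Z ** transpose ?Z = matrix_inv ?T ** (?Y ** transpose ?Y) ** matrix_inv ?T"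
      by (simp only: mult_mult_transpose spd_symmetric[OF spd_matrix_inv[OF T]])
    also have "\<dots> = matrix_inv ?T ** (?T ** C ** ?T) ** matrix_inv ?T"
      by (simp only: YY OT_pushforward[OF C B])
    also have "\<dots> = (matrix_inv ?T ** ?T) ** C ** (?T ** matrix_inv ?T)"
      by (simp only: matrix_mul_assoc)
    finally have ZZ: "?Z ** transpose ?Z = C" by (simp add: inv)
    have "?w \<le> (norm (?X - ?Z))\<^sup>2"
      using W2_square_le_coupling[of ?X ?Z] A C by (simp only: XX ZZ)
    then have "?c * ?w \<le> ?c * (norm (?X - ?Z))\<^sup>2"
      using lambda_min_pos[OF B] mean_lambda_max_pos by (intro mult_left_mono) simp_all
    also have "?c * (norm (?X - ?Z))\<^sup>2 \<le> (?X - ?Z) \<bullet> (?T ** (?X - ?Z))"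
    proof -
      have "?T - ?c *\<^sub>R mat 1 \<in> psd"
        using OT_ge_scaled_identity[OF C B mean_lambda_max_pos barycenter_le_mean_lambda_max]
          spd_symmetric[OF T]
        by (simp add: psd_def transpose_distribs algebra_simps flip: scaleR_matrix_vector_assoc)
      from psd_inner_matrix[OF this, of "?X - ?Z"]
      have "0 \<le> (?X - ?Z) \<bullet> (?T ** (?X - ?Z) - ?c *\<^sub>R (?X - ?Z))"
        by (simp only: matrix_mult_distribs(3,5) matrix_mul_lid)
      then show ?thesis
        by (simp only: inner_diff_right[of _ "_ ** _"] inner_scaleR_right power2_norm_eq_inner)
    qed
    also have "\<dots> = ?X \<bullet> (?T ** ?X) + ?Y \<bullet> (matrix_inv ?T ** ?Y) - 2 * (?X \<bullet> ?Y)"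
      by (rule young_spd[OF T, symmetric])
    also have "?X \<bullet> (?T ** ?X) = ?T \<bullet> A" by (simp only: inner_mult_self XX)
    also have "?Y \<bullet> (matrix_inv ?T ** ?Y) = ?T \<bullet> C"
      by (simp only: inner_mult_self YY OT_inverse_inner[OF C B])
    also have "?X \<bullet> ?Y = OT A B \<bullet> A" by (simp only: inner_mult_self XX)
    finally have "?c * ?w \<le> ?T \<bullet> A + ?T \<bullet> C - 2 * (OT A B \<bullet> A)" .
    moreover have "?c * ?w = sqrt (lambda_min B) * (?w / sqrt ?L)" by (simp add: real_sqrt_divide)
    ultimately show "trace A + trace B - OT C B \<bullet> A - OT C B \<bullet> C + sqrt (lambda_min B) * (?w / sqrt ?L)
        \<le> (W2 A B)\<^sup>2"
      unfolding W2_square_eq_coupling(2)[OF A B] by linarith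
  qed
  also have "(\<integral>B. (W2 A B)\<^sup>2 \<partial>P) = 2 * bary_F P A" by (simp add: bary_F_def)
  also have "(\<integral>B. trace A + trace B - OT C B \<bullet> A - OT C B \<bullet> C + sqrt (lambda_min B) * (?w / sqrt ?L) \<partial>P)
      = trace A + (\<integral>B. trace B \<partial>P) - trace A - trace C + mean_sqrt_lambda_min * (?w / sqrt ?L)"
    using integrable_trace integrable_OT_inner[OF C] integrable_sqrt_lambda_min
    by (simp add: integral_OT_inner[OF C] avg_OT_barycenter mat_1_inner prob_space)
  also have "mean_sqrt_lambda_min * (?w / sqrt ?L) = ?w / sqrt (kappa_bar P)"
    using arg_cong[OF sqrt_kappa_bar, of "\<lambda>z. z * ?w"] by simp
  finally show ?thesis
    using bary_F_eq[OF C] by (simp add: avg_OT_barycenter mat_1_inner field_simps)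
qed

section \<open>Gradient domination\<close>

text \<open>A lower bound for the optimal value through dual potentials. The quadratic potentials whose gradients
  are the transport maps \<open>T\<close> from the current point \<open>A\<close> to each \<open>B\<close> would give the tangent inequality of the convex
  function \<open>A \<mapsto> bary_F P A\<close>. It is useless where \<open>A\<close> is nearly singular, since \<open>T\<close> is unbounded there. Therefore
  \<open>T\<close> is used only on the range of the projector \<open>E\<close>, while the complementary components, seen by \<open>Q\<close>,
  are paired with the identity potential. Each dimension of the range of \<open>Q\<close> then costs at most
  \<open>mean_lambda_max\<close>, and \<open>k\<close> counts these dimensions.\<close>

lemma duality_bound:
  fixes E Q :: "real^'n^'n"
  assumes A: "A \<in> spd"
    and sym: "transpose E = E" "transpose Q = Q" and E: "E ** E = E" and Q: "Q ** Q = Q" and PQ: "E + Q = mat 1"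
    and k: "\<And>B. B \<in> spd \<Longrightarrow> Q \<bullet> B \<le> lambda_max B * k"
  shows "2 * (bary_F P A - bary_F P C)
    \<le> trace A - avg_OT A \<bullet> A - (mat 1 - avg_OT A) \<bullet> (E ** C ** E) + mean_lambda_max * k"
proof -
  note C = barycenter_spd
  let ?Y = "mat_sqrt C"
  have YY: "?Y ** transpose ?Y = C" by (rule spd_eq_coupling_square[OF C])
  have pt: "2 * (OT C B \<bullet> C) \<le> OT A B \<bullet> (E ** C ** E + A) + Q \<bullet> C + lambda_max B * k"
    if B: "B \<in> spd" for B
  proof -
    let ?T = "OT A B" and ?Z = "OT C B ** ?Y"
    note T = OT_spd[OF A B]
    have ZZ: "?Z ** transpose ?Z = B"
      by (simp only: mult_mult_transpose YY OT_pushforward[OF C B] spd_symmetric[OF OT_spd[OF C B]])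
    have Qs: "(Q ** X) \<bullet> (Q ** X') = (Q ** X) \<bullet> X'" for X X' :: "real^'n^'n"
      using inner_matrix_mult_left[of Q X' "Q ** X"]
      by (simp add: sym Q matrix_mul_assoc inner_commute)
    have Qn: "(Q ** X) \<bullet> (Q ** X) = Q \<bullet> (X ** transpose X)" for X :: "real^'n^'n"
      using Qs[of X X] inner_matrix_mult_right[of Q X X] by simp
    have "OT C B \<bullet> C = ?Y \<bullet> ?Z" by (simp only: inner_mult_self YY)
    also have "\<dots> = ((E + Q) ** ?Y) \<bullet> ?Z" by (simp add: PQ)
    also have "\<dots> = (E ** ?Y) \<bullet> ?Z + (Q ** ?Y) \<bullet> (Q ** ?Z)"
      by (simp add: matrix_mult_distribs inner_add_left Qs)
    finally have e: "OT C B \<bullet> C = (E ** ?Y) \<bullet> ?Z + (Q ** ?Y) \<bullet> (Q ** ?Z)" .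
    have "2 * ((E ** ?Y) \<bullet> ?Z) \<le> (E ** ?Y) \<bullet> (?T ** (E ** ?Y)) + ?Z \<bullet> (matrix_inv ?T ** ?Z)"
      by (rule young_spd_le[OF T])
    also have "(E ** ?Y) \<bullet> (?T ** (E ** ?Y)) = ?T \<bullet> (E ** C ** E)"
      by (simp only: inner_mult_self mult_mult_transpose YY sym)
    also have "?Z \<bullet> (matrix_inv ?T ** ?Z) = ?T \<bullet> A"
      by (simp only: inner_mult_self ZZ OT_inverse_inner[OF A B])
    finally have 1: "2 * ((E ** ?Y) \<bullet> ?Z) \<le> ?T \<bullet> (E ** C ** E) + ?T \<bullet> A" .
    have "0 \<le> (Q ** ?Y - Q ** ?Z) \<bullet> (Q ** ?Y - Q ** ?Z)" by (rule inner_ge_zero)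
    then have "2 * ((Q ** ?Y) \<bullet> (Q ** ?Z)) \<le> (Q ** ?Y) \<bullet> (Q ** ?Y) + (Q ** ?Z) \<bullet> (Q ** ?Z)"
      by (simp add: inner_diff_left inner_diff_right inner_commute)
    also have "\<dots> = Q \<bullet> C + Q \<bullet> B" by (simp only: Qn YY ZZ)
    finally show ?thesis using 1 k[OF B] by (simp add: e inner_add_right)
  qed
  have "(\<integral>B. 2 * (OT C B \<bullet> C) \<partial>P)
      \<le> (\<integral>B. OT A B \<bullet> (E ** C ** E + A) + Q \<bullet> C + lambda_max B * k \<partial>P)"
    using pt integrable_OT_inner[OF C] integrable_OT_inner[OF A] integrable_lambda_max
    by (intro integral_mono) (simp_all add: space_P)
  also have "(\<integral>B. 2 * (OT C B \<bullet> C) \<partial>P) = 2 * trace C"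
    by (simp add: integral_OT_inner[OF C] avg_OT_barycenter mat_1_inner)
  also have "(\<integral>B. OT A B \<bullet> (E ** C ** E + A) + Q \<bullet> C + lambda_max B * k \<partial>P)
      = avg_OT A \<bullet> (E ** C ** E + A) + Q \<bullet> C + mean_lambda_max * k"
    using integrable_OT_inner[OF A] integrable_lambda_max
    by (simp add: integral_OT_inner[OF A] prob_space norm_lambda_max_one_def)
  finally have 1: "2 * trace C
    \<le> avg_OT A \<bullet> (E ** C ** E) + avg_OT A \<bullet> A + Q \<bullet> C + mean_lambda_max * k"
    by (simp add: inner_add_right)
  have 2: "2 * (bary_F P A - bary_F P C) = trace A - 2 * (avg_OT A \<bullet> A) + trace C"
    using bary_F_eq[OF A] bary_F_eq[OF C] by (simp add: avg_OT_barycenter mat_1_inner)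
  have "trace C = (E + Q) \<bullet> C" by (simp add: PQ mat_1_inner)
  moreover have "mat 1 \<bullet> (E ** C ** E) = E \<bullet> C"
    using inner_matrix_mult_right[of "E ** C" E "mat 1"] inner_matrix_mult_left[of E C E]
    by (simp add: sym E inner_commute)
  ultimately show ?thesis
    using 1 2 by (simp add: inner_diff_left inner_add_left)
qed

text \<open>The bound \<open>T \<ge> sqrt (lambda_min B) A\<^bsup>-1/2\<^esup>\<close>, tested on an eigenvector and averaged.\<close>

lemma avg_OT_ge_mat_sqrt_inverse:
  assumes A: "A \<in> spd" and u: "u \<bullet> u = 1" "mat_sqrt A *v u = r *\<^sub>R u" and r: "0 < r"
  shows "mean_sqrt_lambda_min \<le> r * (u \<bullet> (avg_OT A *v u))"
proof -
  note symR = symmetric_inner_commute[OF spd_symmetric[OF mat_sqrt_spd[OF A]]]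
  have "mean_sqrt_lambda_min \<le> (\<integral>B. r * (u \<bullet> (OT A B *v u)) \<partial>P)"
  proof (intro integral_mono integrable_sqrt_lambda_min)
    show "integrable P (\<lambda>B. r * (u \<bullet> (OT A B *v u)))" using integrable_OT_form[OF A] by simp
    fix B assume "B \<in> space P"
    then have B: "B \<in> spd" by (simp add: space_P)
    have "sqrt (lambda_min B) * (u \<bullet> (mat_sqrt A *v u))
        \<le> u \<bullet> ((mat_sqrt A ** OT A B ** mat_sqrt A) *v u)"
      by (rule OT_ge_mat_sqrt_inverse[OF A B])
    also have "\<dots> = (mat_sqrt A *v u) \<bullet> (OT A B *v (mat_sqrt A *v u))"
      by (simp only: symR matrix_vector_mul_assoc[symmetric])
    finally have "sqrt (lambda_min B) * r \<le> (r * (u \<bullet> (OT A B *v u))) * r"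
      by (simp add: u matrix_vector_mult_scaleR mult_ac)
    then show "sqrt (lambda_min B) \<le> r * (u \<bullet> (OT A B *v u))"
      using r by (rule mult_right_le_imp_le)
  qed
  also have "\<dots> = r * (u \<bullet> (avg_OT A *v u))" by (simp add: integral_OT_form[OF A])
  finally show ?thesis .
qed

text \<open>A gradient domination inequality at every positive definite \<open>A\<close>, however ill-conditioned. Let \<open>a\<close> be the
  mean of \<open>sqrt lambda_min\<close> and split an eigenbasis of \<open>R = mat_sqrt A\<close> at the threshold \<open>a / 2\<close>.

  An eigenvector with eigenvalue \<open>r < a / 2\<close> contributes at least \<open>(a - r)\<^sup>2 \<ge> a\<^sup>2 / 4\<close> to the squared gradient
  norm, because there the average transport map is at least \<open>a / r\<close>. This pays for the cost \<open>L\<close> per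
  dimension in the duality bound.

  On the span \<open>E\<close> of the other eigenvectors \<open>A\<close> is at least \<open>a\<^sup>2 / 4\<close>, while \<open>C\<close> is at most \<open>L\<close>. There the bound is a
  difference of the quadratic form of \<open>G\<close> at \<open>E R\<close> and at \<open>E Y\<close>, where \<open>Y\<close> is the optimal partner of \<open>R\<close> in \<open>C\<close>.
  It factors as a product of \<open>E R - E Y\<close>, controlled by the variance inequality, and \<open>G (E R + E Y)\<close>, controlled
  by the gradient since \<open>C\<close> is dominated by a multiple of \<open>A\<close> on \<open>E\<close>.\<close>

theorem PL_inequality:
  assumes A: "A \<in> spd"
  shows "bary_F P A - bary_F P C \<le> 5 * kappa_bar P * sqrt (kappa_bar P) * gradient_norm_sq A"
proof -
  note C = barycenter_spd
  define a where "a = mean_sqrt_lambda_min"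
  define L where "L = mean_lambda_max"
  define \<kappa> where "\<kappa> = kappa_bar P"
  define s where "s = sqrt \<kappa>"
  have a: "0 < a" unfolding a_def by (rule mean_sqrt_lambda_min_pos)
  have \<kappa>: "1 \<le> \<kappa>" unfolding \<kappa>_def by (rule kappa_bar_ge_1)
  have L: "L = \<kappa> * a\<^sup>2"
    using a by (simp add: \<kappa>_def L_def kappa_bar_def norm_lambda_min_half_def a_def)
  have s: "1 \<le> s" using \<kappa> by (simp add: s_def)
  let ?R = "mat_sqrt A" and ?M = "avg_OT A"
  define G where "G = mat 1 - ?M"
  define D where "D = bary_F P A - bary_F P C"
  note R = mat_sqrt_spd[OF A]
  have RR: "?R ** transpose ?R = A" by (rule spd_eq_coupling_square[OF A])
  have symG: "transpose G = G"
    using psd_symmetric[OF avg_OT_psd[OF A]] by (simp add: G_def transpose_distribs)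
  obtain u r where u: "orthonormal u" and r: "\<And>i. ?R *v u i = r i *\<^sub>R u i"
    using symmetric_diagonalizable[OF spd_symmetric[OF R]] by blast
  have uu: "u i \<bullet> u i = 1" for i using u by (simp add: orthonormal_def)
  then have u0: "u i \<noteq> 0" for i by (metis inner_zero_left zero_neq_one)
  have rpos: "0 < r i" for i using spd_pos[OF R u0, of i] by (simp add: r uu)
  have key: "a \<le> r i * (u i \<bullet> (?M *v u i))" for i
    unfolding a_def by (rule avg_OT_ge_mat_sqrt_inverse[OF A uu r rpos])
  define p where "p i = (if a / 2 \<le> r i then 1 else 0 :: real)" for i
  have p: "0 \<le> p i" "p i \<le> 1" "p i * p i = p i" "(1 - p i) * (1 - p i) = 1 - p i" for i
    by (simp_all add: p_def)
  define E where "E = spectral_matrix u p"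
  define Q where "Q = spectral_matrix u (\<lambda>i. 1 - p i)"
  define k where "k = (\<Sum>i\<in>UNIV. 1 - p i)"
  have Eu: "E *v u i = p i *\<^sub>R u i" and Qu: "Q *v u i = (1 - p i) *\<^sub>R u i" for i
    unfolding E_def Q_def by (rule spectral_matrix_basis[OF u])+
  have sym: "transpose E = E" "transpose Q = Q"
    unfolding E_def Q_def by (rule spectral_matrix_symmetric)+
  have PQ: "E + Q = mat 1"
    by (rule orthonormal_matrix_eqI[OF u]) (simp add: Eu Qu algebra_simps)
  have QQ: "Q ** Q = Q" and PP: "E ** E = E" and RP: "?R ** E = E ** ?R"
    by (rule orthonormal_matrix_eqI[OF u];
        simp add: Eu Qu r p matrix_vector_mult_scaleR mult.commute flip: matrix_vector_mul_assoc)+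
  have Qk: "Q \<bullet> B \<le> lambda_max B * k" if B: "B \<in> spd" for B
  proof -
    have "Q \<bullet> B = (\<Sum>i\<in>UNIV. (1 - p i) * (u i \<bullet> (B *v u i)))"
      by (simp add: inner_matrix_orthonormal[OF u] Qu)
    also have "\<dots> \<le> (\<Sum>i\<in>UNIV. (1 - p i) * (lambda_max B * (u i \<bullet> u i)))"
      by (intro sum_mono mult_left_mono lambda_max_ge spd_symmetric B) (simp add: p)
    finally show ?thesis by (simp add: k_def uu sum_distrib_left mult.commute)
  qed
  \<comment> \<open>the shares of the squared gradient norm on the ranges of \<open>E\<close> and of \<open>Q\<close>\<close>
  define N\<^sub>1 where "N\<^sub>1 = (\<Sum>i\<in>UNIV. p i * ((r i)\<^sup>2 * ((G *v u i) \<bullet> (G *v u i))))"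
  define N\<^sub>2 where "N\<^sub>2 = (\<Sum>i\<in>UNIV. (1 - p i) * ((r i)\<^sup>2 * ((G *v u i) \<bullet> (G *v u i))))"
  have N: "gradient_norm_sq A = N\<^sub>1 + N\<^sub>2"
    unfolding gradient_norm_sq_def G_def[symmetric] power2_norm_eq_inner inner_matrix_orthonormal[OF u]
    by (simp add: N\<^sub>1_def N\<^sub>2_def r matrix_vector_mult_scaleR power2_eq_square algebra_simps
        flip: sum.distrib matrix_vector_mul_assoc)
  have N_nonneg: "0 \<le> N\<^sub>1" "0 \<le> N\<^sub>2"
    unfolding N\<^sub>1_def N\<^sub>2_def by (intro sum_nonneg mult_nonneg_nonneg; simp add: p)+
  have Gu: "u i \<bullet> (G *v u i) = 1 - u i \<bullet> (?M *v u i)" for i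
    by (simp add: G_def algebra_simps uu)
  have N2: "a\<^sup>2 / 4 * k \<le> N\<^sub>2"
  proof -
    have "(1 - p i) * (a\<^sup>2 / 4) \<le> (1 - p i) * ((r i)\<^sup>2 * ((G *v u i) \<bullet> (G *v u i)))" for i
    proof (cases "a / 2 \<le> r i")
      case False
      have "a / 2 \<le> - (r i * (u i \<bullet> (G *v u i)))"
        using key[of i] False by (simp add: Gu algebra_simps)
      also have "\<dots> \<le> r i * \<bar>u i \<bullet> (G *v u i)\<bar>"
        using rpos[of i] by (metis abs_ge_minus_self abs_mult abs_of_pos)
      also have "\<dots> \<le> r i * norm (G *v u i)"
        using Cauchy_Schwarz_ineq2[of "u i" "G *v u i"] rpos[of i] uu[of i]
        by (intro mult_left_mono) (simp_all add: norm_eq_sqrt_inner)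
      finally have "(a / 2)\<^sup>2 \<le> (r i * norm (G *v u i))\<^sup>2"
        using a by (intro power_mono) auto
      then show ?thesis
        using False by (simp add: p_def power_mult_distrib power2_norm_eq_inner power_divide)
    qed (simp add: p_def)
    then have "(\<Sum>i\<in>UNIV. (1 - p i) * (a\<^sup>2 / 4)) \<le> N\<^sub>2"
      unfolding N\<^sub>2_def by (rule sum_mono)
    then show ?thesis unfolding k_def by (simp only: sum_distrib_right mult.commute)
  qed
  define Y where "Y = OT A C ** ?R"
  have YY: "Y ** transpose Y = C"
    unfolding Y_def
    by (simp only: mult_mult_transpose RR OT_pushforward[OF A C] spd_symmetric[OF OT_spd[OF A C]])
  \<comment> \<open>on the range of \<open>Q\<close> the form \<open>R G R\<close> is at most \<open>r (r - a) \<le> 0\<close>\<close>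
  have RG: "?R \<bullet> (G ** ?R) \<le> (E ** ?R) \<bullet> (G ** (E ** ?R))"
  proof -
    have "r i * (r i * (u i \<bullet> (G *v u i))) \<le> p i * (r i * (r i * (u i \<bullet> (G *v u i))))" for i
    proof (cases "a / 2 \<le> r i")
      case False
      then have "r i * (u i \<bullet> (G *v u i)) \<le> 0"
        using key[of i] a by (simp add: Gu algebra_simps)
      then show ?thesis
        using rpos[of i] False by (simp add: p_def mult_nonneg_nonpos)
    qed (simp add: p_def)
    then have "(\<Sum>i\<in>UNIV. r i * (r i * (u i \<bullet> (G *v u i))))
        \<le> (\<Sum>i\<in>UNIV. p i * (r i * (r i * (u i \<bullet> (G *v u i)))))"
      by (rule sum_mono)
    moreover have pp: "p i * (p i * z) = p i * z" for i z by (simp add: p_def)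
    ultimately show ?thesis
      unfolding inner_matrix_orthonormal[OF u]
      by (simp add: r Eu pp matrix_vector_mult_scaleR mult_ac flip: matrix_vector_mul_assoc)
  qed
  have "2 * D \<le> ?R \<bullet> (G ** ?R) - (E ** Y) \<bullet> (G ** (E ** Y)) + L * k"
  proof -
    have "?R \<bullet> (G ** ?R) = trace A - ?M \<bullet> A"
      by (simp only: inner_mult_self RR) (simp add: G_def inner_diff_left mat_1_inner)
    moreover have "(E ** Y) \<bullet> (G ** (E ** Y)) = G \<bullet> (E ** C ** E)"
      by (simp only: inner_mult_self mult_mult_transpose YY sym)
    ultimately show ?thesis
      using duality_bound[OF A sym PP QQ PQ Qk] by (simp add: D_def G_def L_def)
  qed
  also have "\<dots> \<le> (E ** ?R) \<bullet> (G ** (E ** ?R)) - (E ** Y) \<bullet> (G ** (E ** Y)) + L * k"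
    using RG by simp
  also have "(E ** ?R) \<bullet> (G ** (E ** ?R)) - (E ** Y) \<bullet> (G ** (E ** Y))
      = (E ** ?R - E ** Y) \<bullet> (G ** (E ** ?R) + G ** (E ** Y))"
  proof -
    have "(E ** ?R) \<bullet> (G ** (E ** Y)) = (E ** Y) \<bullet> (G ** (E ** ?R))"
      using inner_matrix_mult_left[of G "E ** Y" "E ** ?R"] symG by (simp add: inner_commute)
    then show ?thesis by (simp add: inner_diff_left inner_add_right)
  qed
  also have "\<dots> \<le> D + 5 * \<kappa> * s * N\<^sub>1"
  proof -
    let ?X = "E ** ?R - E ** Y" and ?g = "G ** (E ** ?R)" and ?h = "G ** (E ** Y)"
    have K: "(G ** E) \<bullet> (G ** E) = (\<Sum>i\<in>UNIV. p i * ((G *v u i) \<bullet> (G *v u i)))"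
      unfolding inner_matrix_orthonormal[OF u]
      by (simp add: Eu matrix_vector_mult_scaleR p(3) mult.assoc[symmetric] flip: matrix_vector_mul_assoc)
    have g: "?g \<bullet> ?g = N\<^sub>1"
      unfolding RP[symmetric] inner_matrix_orthonormal[OF u] N\<^sub>1_def
      by (intro sum.cong refl)
        (simp add: Eu r matrix_vector_mult_scaleR power2_eq_square p_def flip: matrix_vector_mul_assoc)
    \<comment> \<open>\<open>Y\<close> enters only through \<open>Y Y\<^sup>T = C \<le> L I\<close>; what remains, \<open>G E\<close>, is compared with \<open>G R E\<close> through
        \<open>r \<ge> a / 2\<close> on \<open>E\<close>\<close>
    have "?h \<bullet> ?h = (G ** E) \<bullet> ((G ** E) ** C)"
      by (simp only: matrix_mul_assoc[of G] inner_matrix_mult_right[of "G ** E" Y]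
          matrix_mul_assoc[of "G ** E", symmetric] YY)
    also have "\<dots> = transpose (G ** E) \<bullet> (C ** transpose (G ** E))"
      using inner_transpose[of "G ** E" "(G ** E) ** C"]
      by (simp only: matrix_transpose_mul spd_symmetric[OF C])
    also have "\<dots> \<le> L * (transpose (G ** E) \<bullet> transpose (G ** E))"
    proof -
      have "L *\<^sub>R mat 1 - C \<in> psd"
        using barycenter_le_mean_lambda_max spd_symmetric[OF C]
        by (simp add: psd_def L_def transpose_distribs algebra_simps flip: scaleR_matrix_vector_assoc)
      from psd_inner_matrix[OF this, of "transpose (G ** E)"] show ?thesis
        by (simp add: matrix_mult_distribs inner_diff_right)
    qed
    also have "\<dots> = L * ((G ** E) \<bullet> (G ** E))" by (simp only: inner_transpose)
    also have "\<dots> \<le> 4 * \<kappa> * N\<^sub>1"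
    proof -
      have "a\<^sup>2 * (p i * z) \<le> 4 * (p i * ((r i)\<^sup>2 * z))" if "0 \<le> z" for i z
      proof (cases "a / 2 \<le> r i")
        case True
        then have "(a / 2)\<^sup>2 \<le> (r i)\<^sup>2" using a by (intro power_mono) auto
        then have "a\<^sup>2 * z \<le> (4 * (r i)\<^sup>2) * z"
          using that by (intro mult_right_mono) (auto simp: power_divide)
        then show ?thesis using True by (simp add: p_def)
      qed (simp add: p_def)
      then have "a\<^sup>2 * ((G ** E) \<bullet> (G ** E)) \<le> 4 * N\<^sub>1"
        unfolding K N\<^sub>1_def sum_distrib_left by (intro sum_mono) simp
      then have "\<kappa> * (a\<^sup>2 * ((G ** E) \<bullet> (G ** E))) \<le> \<kappa> * (4 * N\<^sub>1)"
        using \<kappa> by (intro mult_left_mono) auto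
      then show ?thesis by (simp add: L mult_ac)
    qed
    finally have h: "?h \<bullet> ?h \<le> 4 * \<kappa> * N\<^sub>1" .
    have "0 \<le> (?g - ?h) \<bullet> (?g - ?h)" by (rule inner_ge_zero)
    then have "(?g + ?h) \<bullet> (?g + ?h) \<le> 2 * (?g \<bullet> ?g) + 2 * (?h \<bullet> ?h)"
      by (simp add: inner_diff_left inner_diff_right inner_add_left inner_add_right inner_commute)
    also have "\<dots> \<le> 2 * N\<^sub>1 + 8 * \<kappa> * N\<^sub>1" using g h by linarith
    also have "\<dots> \<le> 10 * \<kappa> * N\<^sub>1"
      using mult_right_mono[OF \<kappa> N_nonneg(1)] by (simp add: mult.commute)
    finally have gh: "(?g + ?h) \<bullet> (?g + ?h) \<le> 10 * \<kappa> * N\<^sub>1" .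
    have X: "?X \<bullet> ?X \<le> 2 * s * D"
    proof -
      have "?X = E ** (?R - Y)" by (simp add: matrix_mult_distribs)
      also have "(E ** (?R - Y)) \<bullet> (E ** (?R - Y)) \<le> (?R - Y) \<bullet> (?R - Y)"
      proof -
        have "mat 1 - E = Q" using PQ by (simp add: algebra_simps)
        have Qz: "Q ** Z = Z - E ** Z" for Z :: "real^'n^'n"
          by (simp add: matrix_mult_distribs flip: \<open>mat 1 - E = Q\<close>)
        have "(E ** Z) \<bullet> (E ** Z) = Z \<bullet> (E ** Z)" for Z :: "real^'n^'n"
          using inner_matrix_mult_left[of E Z "E ** Z"] by (simp add: sym PP matrix_mul_assoc)
        moreover have "0 \<le> (Q ** Z) \<bullet> (Q ** Z)" for Z :: "real^'n^'n" by (rule inner_ge_zero)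
        ultimately have "(E ** Z) \<bullet> (E ** Z) \<le> Z \<bullet> Z" for Z :: "real^'n^'n"
          unfolding Qz by (simp add: inner_diff_left inner_diff_right inner_commute)
        then show ?thesis .
      qed
      also have "\<dots> = (W2 A C)\<^sup>2"
        unfolding W2_square_eq_coupling(1)[OF A C] Y_def by (simp add: power2_norm_eq_inner)
      also have "\<dots> \<le> 2 * s * D"
        using variance_inequality[OF A] s unfolding D_def[symmetric] \<kappa>_def[symmetric] s_def[symmetric]
        by (simp add: field_simps)
      finally show ?thesis .
    qed
    \<comment> \<open>The weight \<open>1 / s\<close> balances the two squares: \<open>?X \<bullet> ?X \<le> 2 s D\<close> contributes at most \<open>D\<close>, which
        the left-hand side \<open>2 D\<close> absorbs, and the rest is a multiple of the gradient.\<close>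
    have "0 \<le> ((1 / s) *\<^sub>R ?X - (?g + ?h)) \<bullet> ((1 / s) *\<^sub>R ?X - (?g + ?h))" by (rule inner_ge_zero)
    also have "\<dots> = (1 / s)\<^sup>2 * (?X \<bullet> ?X) - 2 / s * (?X \<bullet> (?g + ?h)) + (?g + ?h) \<bullet> (?g + ?h)"
      by (simp add: inner_diff_left[of "_ *\<^sub>R _"] inner_diff_right[of _ "_ *\<^sub>R _"] inner_commute
          power2_eq_square del: inner_add_left)
    finally have "2 / s * (?X \<bullet> (?g + ?h)) \<le> (1 / s)\<^sup>2 * (2 * s * D) + 10 * \<kappa> * N\<^sub>1"
      using gh mult_left_mono[OF X, of "(1 / s)\<^sup>2"] by simp
    then have "s * (2 / s * (?X \<bullet> (?g + ?h))) \<le> s * ((1 / s)\<^sup>2 * (2 * s * D) + 10 * \<kappa> * N\<^sub>1)"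
      using s by (intro mult_left_mono) auto
    then show ?thesis using s by (simp add: algebra_simps power2_eq_square)
  qed
  finally have "D \<le> 5 * \<kappa> * s * N\<^sub>1 + L * k" by simp
  also have "L * k \<le> 4 * \<kappa> * N\<^sub>2"
    using mult_left_mono[OF N2, of "4 * \<kappa>"] \<kappa> by (simp add: L)
  also have "4 * \<kappa> * N\<^sub>2 \<le> 5 * \<kappa> * s * N\<^sub>2"
    using s \<kappa> N_nonneg by (intro mult_right_mono) (auto simp: mult_mono)
  finally show ?thesis
    by (simp add: D_def N \<kappa>_def s_def algebra_simps)
qed

section \<open>Convergence of gradient descent\<close>

text \<open>At step size \<open>1 / (2 \<kappa>)\<close> with \<open>\<kappa> \<ge> 1\<close> the guaranteed decrease is at least \<open>3 / (8 \<kappa>)\<close> times the squared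
  gradient norm, hence at least \<open>3 / (40 \<kappa>\<^bsup>5/2\<^esup>)\<close> times the optimality gap, and \<open>3/40 \<ge> 3/64\<close>.\<close>

lemma gradient_step_contraction:
  assumes A: "A \<in> spd"
  defines "\<eta> \<equiv> 1 / (2 * kappa_bar P)"
  defines "S \<equiv> (1 - \<eta>) *\<^sub>R mat 1 + \<eta> *\<^sub>R avg_OT A"
  shows "S ** A ** S \<in> spd"
    and "bary_F P (S ** A ** S) - bary_F P C
      \<le> exp (- 3 / (64 * kappa_bar P powr (5/2))) * (bary_F P A - bary_F P C)"
proof -
  define \<kappa> where "\<kappa> = kappa_bar P"
  define s where "s = sqrt \<kappa>"
  define D where "D = bary_F P A - bary_F P C"
  have \<kappa>: "1 \<le> \<kappa>" unfolding \<kappa>_def by (rule kappa_bar_ge_1)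
  have s: "1 \<le> s" "s * s = \<kappa>" using \<kappa> by (simp_all add: s_def)
  have \<eta>: "0 < \<eta>" "\<eta> < 1" and \<eta>_eq: "\<eta> = 1 / (2 * \<kappa>)"
    using \<kappa> by (simp_all add: \<eta>_def \<kappa>_def)
  show "S ** A ** S \<in> spd"
    unfolding S_def by (rule gradient_step_decrease(1)[OF A \<eta>])
  have D: "0 \<le> D" unfolding D_def using barycenter_le[OF A] by simp
  have gain: "3 / (8 * \<kappa>) \<le> \<eta> - \<eta>\<^sup>2 / 2"
    unfolding \<eta>_eq using \<kappa> by (simp add: field_simps power2_eq_square)
  then have "0 \<le> \<eta> - \<eta>\<^sup>2 / 2"
    by (rule order_trans[rotated]) (use \<kappa> in simp)
  moreover have "D / (5 * \<kappa> * s) \<le> gradient_norm_sq A"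
    using PL_inequality[OF A] \<kappa> s
    by (simp add: D_def \<kappa>_def s_def divide_le_eq mult_ac)
  ultimately have "3 / (8 * \<kappa>) * (D / (5 * \<kappa> * s)) \<le> (\<eta> - \<eta>\<^sup>2 / 2) * gradient_norm_sq A"
    using gain \<kappa> s D by (intro mult_mono) simp_all
  moreover have "3 / (64 * (\<kappa>\<^sup>2 * s)) * D \<le> 3 / (8 * \<kappa>) * (D / (5 * \<kappa> * s))"
  proof -
    have "3 / (8 * \<kappa>) * (D / (5 * \<kappa> * s)) = 3 / (40 * (\<kappa>\<^sup>2 * s)) * D"
      using \<kappa> s by (simp add: power2_eq_square)
    moreover have "3 / (64 * (\<kappa>\<^sup>2 * s)) \<le> 3 / (40 * (\<kappa>\<^sup>2 * s))"
      using \<kappa> s by (intro divide_left_mono) auto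
    ultimately show ?thesis using mult_right_mono[OF _ D] by metis
  qed
  moreover have "bary_F P (S ** A ** S) \<le> bary_F P A - (\<eta> - \<eta>\<^sup>2 / 2) * gradient_norm_sq A"
    unfolding S_def by (rule gradient_step_decrease(2)[OF A \<eta>])
  ultimately have "bary_F P (S ** A ** S) - bary_F P C \<le> (1 + - (3 / (64 * (\<kappa>\<^sup>2 * s)))) * D"
    by (simp add: D_def algebra_simps)
  also have "\<dots> \<le> exp (- (3 / (64 * (\<kappa>\<^sup>2 * s)))) * D"
    by (rule mult_right_mono[OF exp_ge_add_one_self D])
  also have "\<kappa>\<^sup>2 * s = \<kappa> powr (5/2)"
  proof -
    have "\<kappa> powr (5/2) = \<kappa> powr (2 + 1/2)" by simp
    also have "\<dots> = \<kappa>\<^sup>2 * s"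
      unfolding powr_add using \<kappa> by (simp add: s_def powr_half_sqrt)
    finally show ?thesis by simp
  qed
  finally show "bary_F P (S ** A ** S) - bary_F P C
      \<le> exp (- 3 / (64 * kappa_bar P powr (5/2))) * (bary_F P A - bary_F P C)"
    by (simp add: D_def \<kappa>_def)
qed

lemma gd_convergence:
  assumes A: "A \<in> spd"
  defines "\<eta> \<equiv> 1 / (2 * kappa_bar P)"
  shows "gd P \<eta> A T \<in> spd \<and>
    bary_F P (gd P \<eta> A T) - bary_F P C
      \<le> exp (- (3 * real T) / (64 * kappa_bar P powr (5/2))) * (bary_F P A - bary_F P C)"
proof (induction T)
  case 0
  show ?case using A by simp
next
  case (Suc T)
  let ?c = "3 / (64 * kappa_bar P powr (5/2))"
  let ?A = "gd P \<eta> A T"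
  have A': "?A \<in> spd" using Suc by simp
  let ?S = "(1 - \<eta>) *\<^sub>R mat 1 + \<eta> *\<^sub>R avg_OT ?A"
  have step: "gd P \<eta> A (Suc T) = ?S ** ?A ** ?S"
    by (simp add: avg_OT_def OT_def Let_def)
  note c = gradient_step_contraction[OF A', folded \<eta>_def]
  have "bary_F P (?S ** ?A ** ?S) - bary_F P C \<le> exp (- ?c) * (bary_F P ?A - bary_F P C)"
    using c(2) by simp
  also have "\<dots> \<le> exp (- ?c) * (exp (- ?c * real T) * (bary_F P A - bary_F P C))"
    using Suc by (intro mult_left_mono) simp_all
  also have "\<dots> = exp (- ?c * real (Suc T)) * (bary_F P A - bary_F P C)"
  proof -
    have "exp (- ?c) * exp (- ?c * real T) = exp (- ?c * real (Suc T))"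
      unfolding exp_add[symmetric] by (simp add: algebra_simps add_divide_distrib)
    then show ?thesis by (simp only: mult.assoc[symmetric])
  qed
  also have "- ?c * real (Suc T) = - (3 * real (Suc T)) / (64 * kappa_bar P powr (5/2))"
    by (simp only: times_divide_eq_left minus_divide_left mult_minus_left)
  finally show ?case
    unfolding step using c(1) by blast
qed

end

theorem theorem3:
  fixes P :: "(real^'n^'n) measure"
    and \<Sigma>0 \<Sigma>s :: "real^'n^'n"
    and \<eta> :: real
    and T :: nat
  assumes "spd_prob P"
    and "norm_lambda_min_half P > 0"
    and "integrable P lambda_max"
    and "is_barycenter P \<Sigma>s"
    and "\<Sigma>0 \<in> supp P"
    and "\<eta> = 1 / (2 * kappa_bar P)"
  shows "1 / (2 * sqrt (kappa_bar P)) * (W2 (gd P \<eta> \<Sigma>0 T) \<Sigma>s)\<^sup>2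
           \<le> bary_F P (gd P \<eta> \<Sigma>0 T) - bary_F P \<Sigma>s
         \<and> bary_F P (gd P \<eta> \<Sigma>0 T) - bary_F P \<Sigma>s
           \<le> exp (- (3 * real T) / (64 * kappa_bar P powr (5/2)))
              * (bary_F P \<Sigma>0 - bary_F P \<Sigma>s)"
proof -
  interpret prob_space P using assms(1) by (simp add: spd_prob_def)
  interpret barycenter_problem P \<Sigma>s
    using assms(1-4) by unfold_locales (simp_all add: spd_prob_def)
  have "\<Sigma>0 \<in> spd" using assms(5) by (simp add: supp_def space_P)
  note conv = gd_convergence[OF this, of T, folded assms(6)]
  show ?thesis
    using variance_inequality[OF conv[THEN conjunct1]] conv[THEN conjunct2] by simp
qed

end
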